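(* Let $\xi'=\sum_{i\ge 0}\sum_{j=1}^{L'_i}\delta_{T'_i+T'_{ij}}$ be a renewal cluster point process with increments $X'_i$, $\mu=\mathbb{E}X'_1$, and $R'_i=\sup_{j\le L'_i}|T'_{ij}|$. Suppose that $L'_0$, $L'_1$, $L'_1X'_1$ and $L'_1R'_1$ all have finite mean, and that $g:\mathbb{R}_+\to\mathbb{R}_+$ is a directly Riemann integrable function. Then $$\lim_{t\to\infty}\int_0^t g(t-y)\,dU_{\xi'}(y)=\frac1\mu\,\mathbb{E}[L'_1]\int_0^\infty g(y)\,dy,$$ where $U_{\xi'}$ is the renewal measure of $\xi'$.
   Context: Notation: $\mathbb{R}_+=[0,\infty)$; $M_p(\mathbb{R})$ is the space of point measures on $\mathbb{R}$ finite on all bounded sets. A nonnegative random variable is nonarithmetic if its law is not concentrated on $h\mathbb{Z}$ for any $h>0$. Renewal cluster point process $\xi'$: let $(X'_i)_{i\ge1}$ be nonnegative random variables with a nonarithmetic distribution and finite mean $\mu>0$, and let $\xi'_i$, $i\ge 1$, be point processes on $\mathbb{R}$ such that the pairs $W'_i=(\xi'_i,X'_i)$, $i\ge1$, are i.i.d. ($\xi'_i$ and $X'_i$ may be dependent). Let $W'_0=(\xi'_0,X'_0)$ be a random element of $M_p(\mathbb{R})\times\mathbb{R}_+$ independent of $(W'_i)_{i\ge1}$ (its law may differ from that of $W'_1$). Each $\xi'_i=\sum_{j=1}^{L'_i}\delta_{T'_{ij}}$, where $L'_i$ is an $\mathbb{N}_0$-valued random variable, assumed almost surely finite for every $i\ge0$,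 and $T'_{i1},T'_{i2},\ldots$ are real random variables; $W'_i$ is identified with $(L'_i,(T'_{ij})_j,X'_i)$, a random element of $\mathbb{N}_0\times\mathbb{R}^{\mathbb{N}}\times\mathbb{R}_+$. Put $T'_i=\sum_{j=0}^iX'_j$, $i\ge0$, and $\xi'(B)=\sum_{i\ge0}\xi'_i(B-T'_i)=\sum_{i\ge0}\sum_{j=1}^{L'_i}\delta_{T'_i+T'_{ij}}(B)$ for Borel $B\subseteq\mathbb{R}$; it is assumed throughout that almost surely $\xi'(B)<\infty$ for all bounded Borel $B$. Here $R'_i=\sup_{j\le L'_i}|T'_{ij}|\in[0,\infty)$, $i\ge0$, with $R'_i=0$ if $L'_i=0$. Renewal function and measure: $U_{\xi'}(t)=\mathbb{E}\big[\sum_{i=0}^\infty\sum_{j=1}^{L'_i}\mathbf{1}_{\{T'_i+T'_{ij}\le t\}}\big]$, $t\in\mathbb{R}$. Under the stated moment assumptions this is finite, nondecreasing and right-continuous, and $U_{\xi'}$ also denotes the unique measure on $\mathbb{R}$ with $U_{\xi'}((-\infty,t])=U_{\xi'}(t)$ for all $t\in\mathbb{R}$. The integral $\int_0^t$ with respect to $U_{\xi'}$ is taken over $(0,t]$. Direct Riemann integrability of $g:\mathbb{R}_+\to\mathbb{R}_+$: with $\overline\sigma(h)=h\sum_{k\ge1}\sup_{(k-1)h\le y<kh}g(y)$ and $\underline\sigma(h)=h\sum_{k\ge1}\inf_{(k-1)h\le y<kh}g(y)$, one has $\overline\sigma(h)<\infty$ for all $h>0$ and $\overline\sigma(h)-\underline\sigma(h)\to0$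 as $h\to0$. *)

theory Defs
  imports "HOL-Probability.Probability"
begin

definition nonarithmetic :: "real measure \<Rightarrow> bool" where
  "nonarithmetic D \<longleftrightarrow> (\<forall>h>0. \<not> (AE x in D. x \<in> range (\<lambda>k::int. h * of_int k)))"

text \<open>
  A cluster together with its increment is encoded by the number \<open>L i\<close> of points, the relative
  positions \<open>T i 1, T i 2, \<dots>\<close> (of which only the first \<open>L i\<close> matter), and the increment \<open>X i\<close>.
\<close>

definition mark_space :: "(nat \<times> (nat \<Rightarrow> real) \<times> real) measure" where
  "mark_space = count_space UNIV \<Otimes>\<^sub>M (\<Pi>\<^sub>M j\<in>{1..}. borel) \<Otimes>\<^sub>M borel"

definition mark ::
  "(nat \<Rightarrow> 'a \<Rightarrow> real) \<Rightarrow> (nat \<Rightarrow> 'a \<Rightarrow> nat) \<Rightarrow> (nat \<Rightarrow> nat \<Rightarrow> 'a \<Rightarrow> real) \<Rightarrow>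
    nat \<Rightarrow> 'a \<Rightarrow> nat \<times> (nat \<Rightarrow> real) \<times> real" where
  "mark X L T i \<omega> = (L i \<omega>, (\<lambda>j\<in>{1..}. T i j \<omega>), X i \<omega>)"

definition renewal_epoch :: "(nat \<Rightarrow> 'a \<Rightarrow> real) \<Rightarrow> nat \<Rightarrow> 'a \<Rightarrow> real" where
  "renewal_epoch X i \<omega> = (\<Sum>j=0..i. X j \<omega>)"

definition cluster_process ::
  "(nat \<Rightarrow> 'a \<Rightarrow> real) \<Rightarrow> (nat \<Rightarrow> 'a \<Rightarrow> nat) \<Rightarrow> (nat \<Rightarrow> nat \<Rightarrow> 'a \<Rightarrow> real) \<Rightarrow>
    'a \<Rightarrow> real set \<Rightarrow> ennreal" where
  "cluster_process X L T \<omega> B =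
    (\<Sum>i. \<Sum>j=1..L i \<omega>. indicator B (renewal_epoch X i \<omega> + T i j \<omega>))"

definition cluster_radius ::
  "(nat \<Rightarrow> 'a \<Rightarrow> nat) \<Rightarrow> (nat \<Rightarrow> nat \<Rightarrow> 'a \<Rightarrow> real) \<Rightarrow> nat \<Rightarrow> 'a \<Rightarrow> real" where
  "cluster_radius L T i \<omega> = (if L i \<omega> = 0 then 0 else (SUP j\<in>{1..L i \<omega>}. \<bar>T i j \<omega>\<bar>))"

text \<open>
  Joint independence of all marks amounts to independence of the marks with index at least 1
  together with independence of the initial mark from them; only the former share a common law.
  Random-variable properties are part of \<open>indep_vars\<close>.
\<close>

locale renewal_cluster_process = prob_space M for M :: "'a measure" +
  fixes X :: "nat \<Rightarrow> 'a \<Rightarrow> real"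
    and L :: "nat \<Rightarrow> 'a \<Rightarrow> nat"
    and T :: "nat \<Rightarrow> nat \<Rightarrow> 'a \<Rightarrow> real"
  assumes indep_marks: "indep_vars (\<lambda>_. mark_space) (mark X L T) UNIV"
    and identically_distributed:
      "\<And>i. i \<ge> 1 \<Longrightarrow> distr M mark_space (mark X L T i) = distr M mark_space (mark X L T 1)"
    and increment_nonneg: "\<And>i \<omega>. \<omega> \<in> space M \<Longrightarrow> X i \<omega> \<ge> 0"
    and increment_nonarithmetic: "nonarithmetic (distr M borel (X 1))"
    and increment_finite_mean: "integrable M (X 1)"
    and increment_mean_pos: "expectation (X 1) > 0"
    and locally_finite:
      "AE \<omega> in M. \<forall>B\<in>sets borel. bounded B \<longrightarrow> cluster_process X L T \<omega> B < \<infinity>"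

definition renewal_fun ::
  "'a measure \<Rightarrow> (nat \<Rightarrow> 'a \<Rightarrow> real) \<Rightarrow> (nat \<Rightarrow> 'a \<Rightarrow> nat) \<Rightarrow> (nat \<Rightarrow> nat \<Rightarrow> 'a \<Rightarrow> real) \<Rightarrow>
    real \<Rightarrow> ennreal" where
  "renewal_fun M X L T t = (\<integral>\<^sup>+\<omega>. cluster_process X L T \<omega> {..t} \<partial>M)"

definition renewal_measure ::
  "'a measure \<Rightarrow> (nat \<Rightarrow> 'a \<Rightarrow> real) \<Rightarrow> (nat \<Rightarrow> 'a \<Rightarrow> nat) \<Rightarrow> (nat \<Rightarrow> nat \<Rightarrow> 'a \<Rightarrow> real) \<Rightarrow>
    real measure" where
  "renewal_measure M X L T =
    (THE U. sets U = sets borel \<and> (\<forall>t. emeasure U {..t} = renewal_fun M X L T t))"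

text \<open>
  Riemann sums over the half-line are taken in \<open>ennreal\<close>, so that suprema and series may be
  infinite. The index \<open>k\<close> below is shifted by one: it ranges over all naturals and stands for the
  cell \<open>[k h, (k + 1) h)\<close>. Only values on the nonnegative half-line enter.
\<close>

definition upper_riemann_sum :: "(real \<Rightarrow> real) \<Rightarrow> real \<Rightarrow> ennreal" where
  "upper_riemann_sum g h =
    ennreal h * (\<Sum>k. SUP y\<in>{real k * h..<real (Suc k) * h}. ennreal (g y))"

definition lower_riemann_sum :: "(real \<Rightarrow> real) \<Rightarrow> real \<Rightarrow> ennreal" where
  "lower_riemann_sum g h =
    ennreal h * (\<Sum>k. INF y\<in>{real k * h..<real (Suc k) * h}. ennreal (g y))"

definition directly_riemann_integrable :: "(real \<Rightarrow> real) \<Rightarrow> bool" where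
  "directly_riemann_integrable g \<longleftrightarrow>
    (\<forall>h>0. upper_riemann_sum g h < \<infinity>) \<and>
    ((\<lambda>h. upper_riemann_sum g h - lower_riemann_sum g h) \<longlongrightarrow> 0) (at_right 0)"

text \<open>
  A directly Riemann integrable function is Lebesgue measurable but need not be Borel measurable,
  whereas \<open>renewal_measure\<close> is a Borel measure that may be singular. Integrals of such
  functions are therefore taken as \<open>nn_integral\<close>: it is the Lebesgue integral for Borel measurable
  integrands and the lower integral otherwise, while a Bochner integral would default to 0.
\<close>

end

theory Submission
  imports Defs
begin

text \<open>
  The theorem is the key renewal theorem for cluster processes. It rests on Blackwell's theorem for
  the renewal measure \<open>W\<close> of the epochs: the expected number of epochs in \<open>(t - h, t]\<close> tends to \<open>h / \<mu>\<close>.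

  The proof of Blackwell's theorem is elementary. Convolving \<open>W\<close> with a uniformly continuous function
  \<open>\<phi>\<close> of bounded support gives a bounded, uniformly continuous function \<open>G\<close> that is asymptotically
  harmonic for the increment law \<open>F\<close>: the difference \<open>G - F * G\<close> tends to 0. A maximum principle at
  infinity, in the spirit of Choquet and Deny, shows that all increments \<open>G t - G (t - c)\<close> tend to 0
  (\<open>increment_tendsto_0\<close>): were the limit superior of such an increment positive, then, \<open>F\<close> being
  nonarithmetic, the increment would be bounded away from 0 along arbitrarily long progressions of step
  \<open>c\<close>, and \<open>G\<close> would be unbounded. The size of \<open>G\<close> is then read off from the identity that sums over the last
  epoch before \<open>t\<close> (\<open>tail_identity\<close>): smoothed by \<open>\<phi>\<close>, it says that the average of \<open>G (t - x)\<close> with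
  weight \<open>F {x<..}\<close> tends to the integral of \<open>\<phi>\<close>; the total weight is \<open>\<mu>\<close>, and \<open>G\<close> is nearly constant on
  bounded stretches, so \<open>G\<close> tends to that integral divided by \<open>\<mu>\<close> (\<open>smoothed_tendsto\<close>). Trapezoidal
  \<open>\<phi>\<close> approximate the indicator of an interval (\<open>blackwell\<close>).

  For clusters, conditioning on the marks shows that the intensity measure is, up
  to the initial cluster, the average of translates of \<open>W\<close> by the points of a typical cluster
  (\<open>emeasure_intensity_decomposition\<close>). Dominated convergence transfers Blackwell's limit and yields
  \<open>h / \<mu>\<close> times the mean cluster size (\<open>intensity_blackwell\<close>). The passage from intervals to directly Riemann
  integrable functions holds for every measure whose window masses are bounded and converge
  (\<open>key_renewal_from_local_limit\<close>).
\<close>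

section \<open>Additive monoids in the half-line\<close>

text \<open>
  If the group generated by \<open>D\<close> had no elements in \<open>(0, \<epsilon>)\<close>, it would be cyclic and \<open>D\<close> would lie in
  a lattice. So \<open>D\<close> contains \<open>a < b\<close> with \<open>d = b - a < \<epsilon>\<close>. The elements \<open>(n - k) a + k b = n a + k d\<close>,
  \<open>k \<le> n\<close>, form a progression of step \<open>d\<close> from \<open>n a\<close> to \<open>n a + n d\<close>; once \<open>n d \<ge> a\<close>, the progressions
  for consecutive \<open>n\<close> leave no room between them.
\<close>

lemma additive_submonoid_eventually_dense:
  fixes D :: "real set"
  assumes zero: "0 \<in> D" and add: "\<And>a b. a \<in> D \<Longrightarrow> b \<in> D \<Longrightarrow> a + b \<in> D"
    and nonneg: "\<And>a. a \<in> D \<Longrightarrow> a \<ge> 0"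
    and nonlattice: "\<And>p. p > 0 \<Longrightarrow> \<not> D \<subseteq> range (\<lambda>k::int. p * of_int k)"
    and eps: "\<epsilon> > 0"
  shows "\<exists>A. \<forall>x\<ge>A. \<exists>s\<in>D. \<bar>x - s\<bar> < \<epsilon>"
proof -
  define H where "H = {b - a |a b. a \<in> D \<and> b \<in> D}"
  have D_H: "a \<in> H" if "a \<in> D" for a
    unfolding H_def using zero that by force
  have H_diff: "u - v \<in> H" if "u \<in> H" "v \<in> H" for u v
  proof -
    obtain a b c d where *: "u = b - a" "v = d - c" "a \<in> D" "b \<in> D" "c \<in> D" "d \<in> D"
      using \<open>u \<in> H\<close> \<open>v \<in> H\<close> unfolding H_def by blast
    have "u - v = (b + c) - (a + d)" using * by simp
    then show ?thesis unfolding H_def using * add by blast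
  qed
  have H0: "0 \<in> H" using D_H zero by blast
  have H_minus: "- u \<in> H" if "u \<in> H" for u using H_diff[OF H0 that] by simp
  have H_nat: "real n * u \<in> H" if "u \<in> H" for u n
  proof (induction n)
    case (Suc n)
    have "real (Suc n) * u = real n * u - (- u)" by (simp add: algebra_simps)
    then show ?case using H_diff[OF Suc H_minus[OF that]] by simp
  qed (simp add: H0)
  have D_nat: "real n * u \<in> D" if "u \<in> D" for u n
  proof (induction n)
    case (Suc n)
    then show ?case using add[OF that Suc] by (simp add: algebra_simps)
  qed (simp add: zero)
  have "\<exists>d\<in>H. 0 < d \<and> d < \<epsilon>"
  proof (rule ccontr)
    assume "\<not> ?thesis"
    then have gap: "d \<ge> \<epsilon>" if "d \<in> H" "d > 0" for d using that by force
    obtain a where "a \<in> D" "a \<notin> range (\<lambda>k::int. 1 * of_int k)"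
      using nonlattice[of 1] by auto
    then have "a \<noteq> 0" by (metis mult_zero_right of_int_0 rangeI)
    with nonneg[OF \<open>a \<in> D\<close>] have "a > 0" by simp
    with D_H[OF \<open>a \<in> D\<close>] have "a \<in> H \<and> a > 0" by simp
    then obtain p where p: "p \<in> H" "p > 0"
      and p_min: "\<And>q. q \<in> H \<and> q > 0 \<Longrightarrow> nat \<lfloor>p / \<epsilon>\<rfloor> \<le> nat \<lfloor>q / \<epsilon>\<rfloor>"
      using ex_has_least_nat[of "\<lambda>q. q \<in> H \<and> q > 0" a "\<lambda>q. nat \<lfloor>q / \<epsilon>\<rfloor>"] by blast
    \<comment> \<open>Positive elements of \<open>H\<close> are at least \<open>\<epsilon>\<close> apart, so minimality of \<open>\<lfloor>p / \<epsilon>\<rfloor>\<close> makes \<open>p\<close>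
        the least of them.\<close>
    have least: "q \<ge> p" if q: "q \<in> H" "q > 0" for q
    proof (rule ccontr)
      assume "\<not> q \<ge> p"
      then have "p - q \<ge> \<epsilon>" using gap[of "p - q"] H_diff p q by simp
      then have "(q + \<epsilon>) / \<epsilon> \<le> p / \<epsilon>" using eps by (intro divide_right_mono) auto
      then have "q / \<epsilon> + 1 \<le> p / \<epsilon>" using eps by (simp add: add_divide_distrib)
      then have "\<lfloor>q / \<epsilon>\<rfloor> + 1 \<le> \<lfloor>p / \<epsilon>\<rfloor>" by linarith
      moreover have "\<lfloor>q / \<epsilon>\<rfloor> \<ge> 0" using q eps by simp
      ultimately show False using p_min[of q] q by linarith
    qed
    have "D \<subseteq> range (\<lambda>k::int. p * of_int k)"
    proof
      fix s assume "s \<in> D"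
      then have s: "s \<in> H" "s \<ge> 0" using D_H nonneg by auto
      define k where "k = nat \<lfloor>s / p\<rfloor>"
      have k: "real k = of_int \<lfloor>s / p\<rfloor>" unfolding k_def using s p by simp
      have "real k \<le> s / p" "s / p < real k + 1" unfolding k by linarith+
      then have "s - real k * p \<ge> 0" "s - real k * p < p" using p by (simp_all add: field_simps)
      moreover have "s - real k * p \<in> H" using H_diff s H_nat p by blast
      ultimately have "s - real k * p = 0" using least[of "s - real k * p"] by force
      then have "s = p * of_int (int k)" by simp
      then show "s \<in> range (\<lambda>k::int. p * of_int k)" by blast
    qed
    with nonlattice p show False by blast
  qed
  then obtain a b where ab: "a \<in> D" "b \<in> D" "0 < b - a" "b - a < \<epsilon>"
    unfolding H_def by blast
  define d where "d = b - a"
  have d: "0 < d" "d < \<epsilon>" using ab by (auto simp: d_def)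
  have in_D: "real n * a + real k * d \<in> D" if "k \<le> n" for n k
  proof -
    have "real n * a + real k * d = real (n - k) * a + real k * b"
      using that by (simp add: d_def of_nat_diff algebra_simps)
    then show ?thesis using add D_nat ab by metis
  qed
  have close: "\<exists>s\<in>D. \<bar>x - s\<bar> < \<epsilon>" if "real n * a \<le> x" "x < real n * a + (real n + 1) * d" for n x
  proof -
    define k where "k = nat \<lfloor>(x - real n * a) / d\<rfloor>"
    have k: "real k = of_int \<lfloor>(x - real n * a) / d\<rfloor>" unfolding k_def using that d by simp
    have kk: "real k \<le> (x - real n * a) / d" "(x - real n * a) / d < real k + 1"
      unfolding k by linarith+
    have "(x - real n * a) / d < real n + 1" using that d by (simp add: field_simps)
    with kk have "real k < real n + 1" by simp
    then have "k \<le> n" by simp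
    moreover have "\<bar>x - (real n * a + real k * d)\<bar> < \<epsilon>"
      using kk d by (simp add: field_simps)
    ultimately show ?thesis using in_D by blast
  qed
  obtain N where N: "real N * d \<ge> a" using d reals_Archimedean3 less_imp_le by blast
  have "\<exists>s\<in>D. \<bar>x - s\<bar> < \<epsilon>" if x: "x \<ge> max 0 (real N * a)" for x
  proof (cases "a = 0")
    case True
    obtain n where "x < real n * d" using d reals_Archimedean3 by blast
    then show ?thesis using close[of n x] True x d by (simp add: algebra_simps)
  next
    case False
    then have a: "a > 0" using nonneg ab by force
    define n where "n = nat \<lfloor>x / a\<rfloor>"
    have "x \<ge> 0" using x by linarith
    then have "x / a \<ge> 0" using a by simp
    then have n: "real n = of_int \<lfloor>x / a\<rfloor>" unfolding n_def by simp
    have nn: "real n \<le> x / a" "x / a < real n + 1" unfolding n by linarith+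
    have "real N \<le> x / a" using x a by (simp add: field_simps)
    then have "N \<le> n" unfolding n_def by linarith
    then have "real N * d \<le> real n * d" using d by simp
    then have "a \<le> real n * d" using N by linarith
    moreover have "x < real n * a + a" "real n * a \<le> x" using nn a by (simp_all add: field_simps)
    ultimately show ?thesis using close[of n x] d by (simp add: algebra_simps)
  qed
  then show ?thesis by blast
qed

section \<open>Asymptotically harmonic functions\<close>

definition support_points :: "real measure \<Rightarrow> real set" where
  "support_points F = {a. \<forall>r>0. emeasure F {a - r<..<a + r} > 0}"

text \<open>
  The complement of the support is a union of null intervals, and intervals with rational end points
  suffice to form it.
\<close>

lemma AE_in_support_points:
  assumes "sets F = sets borel"
  shows "AE x in F. x \<in> support_points F"
proof -
  define I where "I = {(p, q). p \<in> \<rat> \<and> q \<in> \<rat> \<and> emeasure F {p<..<q} = 0}"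
  have "countable I"
    by (rule countable_subset[of _ "\<rat> \<times> \<rat>"]) (auto simp: I_def countable_rat)
  then have "(\<Union>(p, q)\<in>I. {p<..<q}) \<in> null_sets F"
    by (rule null_sets_UN') (auto simp: I_def null_sets_def assms)
  moreover have "{x \<in> space F. x \<notin> support_points F} \<subseteq> (\<Union>(p, q)\<in>I. {p<..<q})"
  proof
    fix x assume "x \<in> {x \<in> space F. x \<notin> support_points F}"
    then obtain r where r: "r > 0" "emeasure F {x - r<..<x + r} = 0"
      by (auto simp: support_points_def)
    obtain p where p: "p \<in> \<rat>" "x - r < p" "p < x" using Rats_dense_in_real[of "x - r" x] r by auto
    obtain q where q: "q \<in> \<rat>" "x < q" "q < x + r" using Rats_dense_in_real[of x "x + r"] r by auto
    have "emeasure F {p<..<q} \<le> emeasure F {x - r<..<x + r}"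
      by (rule emeasure_mono) (use p q in \<open>auto simp: assms\<close>)
    with r p q show "x \<in> (\<Union>(p, q)\<in>I. {p<..<q})" by (auto simp: I_def intro!: bexI[of _ "(p, q)"])
  qed
  ultimately show ?thesis by (rule AE_I')
qed

lemma filterlim_minus_const_at_top: "filterlim (\<lambda>t. t - c) at_top at_top" for c :: real
  using filterlim_tendsto_add_at_top[OF tendsto_const filterlim_ident, of "- c"] by simp

text \<open>
  Up to a vanishing error, \<open>f t\<close> is the \<open>F\<close>-average of the values \<open>f (t - y)\<close>, and for large \<open>t\<close> hardly any
  of them exceed \<open>\<eta>\<close>. If \<open>f (t - a)\<close> lay below \<open>\<eta> - \<epsilon>\<close>, uniform continuity would keep \<open>f (t - y)\<close> below
  \<open>\<eta> - \<epsilon> / 2\<close> for all \<open>y\<close> in a neighbourhood of \<open>a\<close>, which has positive \<open>F\<close>-mass as \<open>a\<close> is in the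
  support; this would push the average \<open>f t\<close> below \<open>\<eta>\<close> by a fixed amount.
\<close>

lemma near_limsup_propagates:
  fixes f :: "real \<Rightarrow> real"
  assumes F: "real_distribution F" and a: "a \<in> support_points F"
    and bounded: "\<And>x. \<bar>f x\<bar> \<le> C" and uc: "uniformly_continuous_on UNIV f"
    and upper: "\<And>\<epsilon>. \<epsilon> > 0 \<Longrightarrow> eventually (\<lambda>t. f t \<le> \<eta> + \<epsilon>) at_top"
    and harmonic: "((\<lambda>t. f t - (\<integral>y. f (t - y) \<partial>F)) \<longlongrightarrow> 0) at_top"
    and eps: "\<epsilon> > 0"
  shows "\<exists>\<delta>>0. eventually (\<lambda>t. f t \<ge> \<eta> - \<delta> \<longrightarrow> f (t - a) \<ge> \<eta> - \<epsilon>) at_top"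
proof -
  interpret F: real_distribution F by fact
  have [measurable]: "f \<in> borel_measurable borel"
    by (intro borel_measurable_continuous_onI uniformly_continuous_imp_continuous uc)
  have C: "C \<ge> 0" using bounded[of 0] by simp
  obtain r where r: "r > 0" "\<And>x y. \<bar>x - y\<bar> < r \<Longrightarrow> \<bar>f x - f y\<bar> < \<epsilon> / 2"
    using uc eps unfolding uniformly_continuous_on_def dist_real_def
    by (metis UNIV_I half_gt_zero)
  define p where "p = measure F {a - r<..<a + r}"
  have p: "p > 0" unfolding p_def using a r
    by (metis (mono_tags, lifting) F.emeasure_eq_measure ennreal_less_zero_iff mem_Collect_eq support_points_def)
  \<comment> \<open>\<open>C'\<close> bounds \<open>f - \<eta>\<close> everywhere. Three errors compete with the loss \<open>p \<epsilon> / 2\<close>: \<open>\<kappa>\<close> from the defect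
      of harmonicity, \<open>\<kappa>\<close> from the excess over the limit superior, and \<open>C' \<kappa>\<close> from the tail of \<open>F\<close>
      beyond \<open>K\<close>.\<close>
  define C' where "C' = C + \<bar>\<eta>\<bar>"
  have C': "C' \<ge> 0" using C by (simp add: C'_def)
  define \<kappa> where "\<kappa> = p * \<epsilon> / 8 / (2 + C')"
  have \<kappa>: "\<kappa> > 0" unfolding \<kappa>_def using p eps C' by simp
  have "(2 + C') * \<kappa> = p * \<epsilon> / 8" 
    unfolding \<kappa>_def times_divide_eq_right[of "2 + C'"]
    by (subst nonzero_mult_div_cancel_left[symmetric, of "2 + C'" "p * \<epsilon> / 8"]) (use C' in auto)
  then have \<kappa>_eq: "2 * \<kappa> + C' * \<kappa> = p * \<epsilon> / 8" by (simp add: algebra_simps)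
  have "eventually (\<lambda>K. cdf F K > 1 - \<kappa>) at_top"
    using F.cdf_lim_at_top_prob \<kappa> by (intro order_tendstoD) auto
  then obtain K where K: "cdf F K > 1 - \<kappa>" by (auto simp: eventually_at_top_linorder)
  have tail: "measure F {K<..} \<le> \<kappa>"
  proof -
    have "{K<..} = space F - {..K}" by auto
    then have "measure F {K<..} = 1 - cdf F K"
      unfolding cdf_def using F.prob_compl[of "{..K}"] by simp
    with K show ?thesis by simp
  qed
  obtain t1 where t1: "\<And>t. t \<ge> t1 \<Longrightarrow> f t \<le> \<eta> + \<kappa>"
    using upper[OF \<kappa>] by (auto simp: eventually_at_top_linorder)
  have ev: "eventually (\<lambda>t. f t - (\<integral>y. f (t - y) \<partial>F) < \<kappa>) at_top"
    using harmonic \<kappa> by (intro order_tendstoD) auto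
  have int: "integrable F (\<lambda>y. f (t - y))" for t
    by (rule F.integrable_const_bound[of _ C]) (use bounded in auto)
  have drop: "f t < \<eta> - p * \<epsilon> / 8"
    if t: "f t - (\<integral>y. f (t - y) \<partial>F) < \<kappa>" "t \<ge> t1 + K" and low: "f (t - a) < \<eta> - \<epsilon>" for t
  proof -
    have "f (t - y) \<le> \<eta> + \<kappa> + C' * indicator {K<..} y - \<epsilon> / 2 * indicator {a - r<..<a + r} y" for y
    proof (cases "y \<in> {a - r<..<a + r}")
      case True
      then have "\<bar>f (t - y) - f (t - a)\<bar> < \<epsilon> / 2" by (intro r) auto
      then have "f (t - y) - f (t - a) < \<epsilon> / 2" by linarith
      with low \<kappa> have "f (t - y) \<le> \<eta> + \<kappa> - \<epsilon> / 2" by linarith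
      with True C' show ?thesis by (auto simp: indicator_def)
    next
      case False
      have "f (t - y) \<le> C" using bounded[of "t - y"] by simp
      then show ?thesis using False \<kappa> t1[of "t - y"] t(2) by (auto simp: indicator_def C'_def)
    qed
    note pointwise = this
    have ind: "integrable F (\<lambda>y. u * indicator S y :: real)" if "S \<in> sets borel" for u S
      using that by (intro integrable_mult_right integrable_real_indicator)
        (auto simp: F.emeasure_finite less_top[symmetric])
    have "(\<integral>y. f (t - y) \<partial>F) \<le>
        (\<integral>y. \<eta> + \<kappa> + C' * indicator {K<..} y - \<epsilon> / 2 * indicator {a - r<..<a + r} y \<partial>F)"
    proof (rule integral_mono[OF int])
      show "integrable F (\<lambda>y. \<eta> + \<kappa> + C' * indicator {K<..} y - \<epsilon> / 2 * indicator {a - r<..<a + r} y)"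
        by (intro Bochner_Integration.integrable_diff Bochner_Integration.integrable_add
            F.integrable_const ind) auto
    qed (rule pointwise)
    also have "\<dots> = \<eta> + \<kappa> + C' * measure F {K<..} - \<epsilon> / 2 * p"
      by (subst Bochner_Integration.integral_diff
          , (intro Bochner_Integration.integrable_add F.integrable_const ind; simp)
          , (intro ind; simp), subst Bochner_Integration.integral_add)
        (use ind[of "{K<..}" 1] F.prob_space in \<open>auto simp: p_def intro!: ind\<close>)
    also have "\<dots> \<le> \<eta> + \<kappa> + C' * \<kappa> - \<epsilon> / 2 * p"
      using tail C' by (simp add: mult_left_mono)
    finally have "f t < \<eta> + (2 * \<kappa> + C' * \<kappa>) - \<epsilon> / 2 * p" using t by linarith
    moreover have "p * \<epsilon> > 0" using p eps by simp
    ultimately show ?thesis unfolding \<kappa>_eq by (simp add: field_simps)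
  qed
  have "eventually (\<lambda>t. f t \<ge> \<eta> - p * \<epsilon> / 8 \<longrightarrow> f (t - a) \<ge> \<eta> - \<epsilon>) at_top"
    using ev eventually_ge_at_top[of "t1 + K"] by eventually_elim (use drop in \<open>fastforce simp: not_le\<close>)
  moreover have "p * \<epsilon> / 8 > 0" using p eps by simp
  ultimately show ?thesis by blast
qed

text \<open>
  Let \<open>\<eta>\<close> be the limit superior of \<open>f t = G t - G (t - c)\<close>. The lags \<open>a\<close> for which a value of \<open>f\<close> near \<open>\<eta>\<close>
  at \<open>t\<close> forces a value near \<open>\<eta>\<close> at \<open>t - a\<close> form an additive monoid that contains the support of \<open>F\<close>;
  as \<open>F\<close> is nonarithmetic, this monoid is eventually \<open>r\<close>-dense for every \<open>r\<close>. Hence there are \<open>t\<close> for which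
  \<open>f\<close> is close to \<open>\<eta>\<close> along a progression \<open>t - A, t - A - c, t - A - 2 c, \<dots>\<close> of any prescribed length \<open>N\<close>.
  Summing \<open>f\<close> along it telescopes to a difference of two values of the bounded function \<open>G\<close>, which
  cannot be of size \<open>N \<eta>\<close> for all \<open>N\<close> unless \<open>\<eta> \<le> 0\<close>.
\<close>

lemma increment_limsup_nonpos:
  fixes G :: "real \<Rightarrow> real"
  assumes F: "real_distribution F" and nonneg: "AE x in F. x \<ge> 0" and na: "nonarithmetic F"
    and bounded: "\<And>x. \<bar>G x\<bar> \<le> B" and uc: "uniformly_continuous_on UNIV G"
    and harmonic: "((\<lambda>t. G t - (\<integral>y. G (t - y) \<partial>F)) \<longlongrightarrow> 0) at_top"
    and c: "c \<ge> 0" and e: "e > 0"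
  shows "eventually (\<lambda>t. G t - G (t - c) < e) at_top"
proof -
  interpret F: real_distribution F by fact
  have [measurable]: "G \<in> borel_measurable borel"
    by (intro borel_measurable_continuous_onI uniformly_continuous_imp_continuous uc)
  define f where "f t = G t - G (t - c)" for t
  have f_bounded: "\<bar>f x\<bar> \<le> 2 * B" for x
    using bounded[of x] bounded[of "x - c"] by (simp add: f_def)
  have uc_shift: "uniformly_continuous_on UNIV (\<lambda>t. G (t - c))"
    using uc unfolding uniformly_continuous_on_def dist_real_def by (metis UNIV_I diff_diff_eq2 diff_add_cancel)
  have f_uc: "uniformly_continuous_on UNIV f"
    unfolding f_def by (intro uniformly_continuous_on_diff uc uc_shift)
  have int: "integrable F (\<lambda>y. G (t - y))" for t
    by (rule F.integrable_const_bound[of _ B]) (use bounded in auto)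
  have "((\<lambda>t. G (t - c) - (\<integral>y. G (t - c - y) \<partial>F)) \<longlongrightarrow> 0) at_top"
    using filterlim_compose[OF harmonic filterlim_minus_const_at_top[of c]] by simp
  from tendsto_diff[OF harmonic this]
  have f_harmonic: "((\<lambda>t. f t - (\<integral>y. f (t - y) \<partial>F)) \<longlongrightarrow> 0) at_top"
    unfolding f_def using int int[of "_ - c"]
    by (subst Bochner_Integration.integral_diff) (auto simp: algebra_simps)
  define E where "E = {b. eventually (\<lambda>t. f t \<le> b) at_top}"
  define \<eta> where "\<eta> = Inf E"
  have E_ne: "2 * B \<in> E" unfolding E_def using f_bounded by (auto simp: abs_le_iff)
  have E_bdd: "bdd_below E"
  proof (rule bdd_belowI[of _ "- (2 * B)"])
    fix b assume "b \<in> E"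
    then obtain t where "f t \<le> b" unfolding E_def by (auto simp: eventually_at_top_linorder)
    then show "- (2 * B) \<le> b" using f_bounded[of t] by simp
  qed
  have upper: "eventually (\<lambda>t. f t \<le> \<eta> + \<epsilon>) at_top" if "\<epsilon> > 0" for \<epsilon>
  proof -
    have "Inf E < \<eta> + \<epsilon>" using that by (simp add: \<eta>_def)
    then obtain b where "b \<in> E" "b < \<eta> + \<epsilon>" using E_ne cInf_lessD by blast
    then show ?thesis unfolding E_def by (auto elim: eventually_mono)
  qed
  have freq: "frequently (\<lambda>t. f t \<ge> \<eta> - \<delta>) at_top" if "\<delta> > 0" for \<delta>
  proof (rule ccontr)
    assume "\<not> ?thesis"
    then have "eventually (\<lambda>t. f t \<le> \<eta> - \<delta>) at_top"
      by (auto simp: not_frequently elim: eventually_mono)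
    then have "\<eta> \<le> \<eta> - \<delta>" unfolding \<eta>_def by (intro cInf_lower E_bdd) (simp add: E_def \<eta>_def)
    with that show False by simp
  qed
  define D where "D = {a. a \<ge> 0 \<and> (\<forall>\<epsilon>>0. \<exists>\<delta>>0. eventually (\<lambda>t. f t \<ge> \<eta> - \<delta> \<longrightarrow> f (t - a) \<ge> \<eta> - \<epsilon>) at_top)}"
  have D_support: "a \<in> D" if "a \<in> support_points F" "a \<ge> 0" for a
    unfolding D_def
    using near_limsup_propagates[OF F that(1) f_bounded f_uc upper f_harmonic] that(2) by auto
  have D0: "0 \<in> D" unfolding D_def by auto
  have D_add: "a + b \<in> D" if "a \<in> D" "b \<in> D" for a b
    unfolding D_def
  proof (intro CollectI conjI allI impI)
    show "a + b \<ge> 0" using that by (auto simp: D_def)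
    fix \<epsilon> :: real assume "\<epsilon> > 0"
    then obtain \<delta> where \<delta>: "\<delta> > 0"
      and ev: "eventually (\<lambda>t. f t \<ge> \<eta> - \<delta> \<longrightarrow> f (t - a) \<ge> \<eta> - \<epsilon>) at_top"
      using \<open>a \<in> D\<close> unfolding D_def by blast
    from \<delta> obtain \<delta>' where \<delta>': "\<delta>' > 0"
      and ev': "eventually (\<lambda>t. f t \<ge> \<eta> - \<delta>' \<longrightarrow> f (t - b) \<ge> \<eta> - \<delta>) at_top"
      using \<open>b \<in> D\<close> unfolding D_def by blast
    have "eventually (\<lambda>t. f (t - b) \<ge> \<eta> - \<delta> \<longrightarrow> f (t - b - a) \<ge> \<eta> - \<epsilon>) at_top"
      using eventually_compose_filterlim[OF ev filterlim_minus_const_at_top[of b]] .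
    with ev' have "eventually (\<lambda>t. f t \<ge> \<eta> - \<delta>' \<longrightarrow> f (t - (a + b)) \<ge> \<eta> - \<epsilon>) at_top"
      by eventually_elim (auto simp: algebra_simps)
    with \<delta>' show "\<exists>\<delta>>0. eventually (\<lambda>t. f t \<ge> \<eta> - \<delta> \<longrightarrow> f (t - (a + b)) \<ge> \<eta> - \<epsilon>) at_top" by blast
  qed
  have D_nonlattice: "\<not> D \<subseteq> range (\<lambda>k::int. p * of_int k)" if "p > 0" for p
  proof
    assume lattice: "D \<subseteq> range (\<lambda>k::int. p * of_int k)"
    have "AE x in F. x \<in> range (\<lambda>k::int. p * of_int k)"
      using AE_in_support_points[OF F.events_eq_borel] nonneg
      by eventually_elim (use D_support lattice in blast)
    with na that show False unfolding nonarithmetic_def by blast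
  qed
  have "\<eta> \<le> 3 * \<epsilon>" if eps: "\<epsilon> > 0" for \<epsilon>
  proof -
    obtain r where r: "r > 0" "\<And>x y. \<bar>x - y\<bar> < r \<Longrightarrow> \<bar>f x - f y\<bar> < \<epsilon>"
      using f_uc eps unfolding uniformly_continuous_on_def dist_real_def by (metis UNIV_I)
    obtain A where A: "\<And>x. x \<ge> A \<Longrightarrow> \<exists>s\<in>D. \<bar>x - s\<bar> < r"
      using additive_submonoid_eventually_dense[OF D0 D_add _ D_nonlattice r(1)]
      unfolding D_def by blast
    have reach: "\<exists>\<delta>>0. eventually (\<lambda>t. f t \<ge> \<eta> - \<delta> \<longrightarrow> f (t - x) \<ge> \<eta> - 2 * \<epsilon>) at_top"
      if x: "x \<ge> A" for x
    proof -
      obtain s where s: "s \<in> D" "\<bar>x - s\<bar> < r" using A x by blast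
      obtain \<delta> where \<delta>: "\<delta> > 0"
        and ev: "eventually (\<lambda>t. f t \<ge> \<eta> - \<delta> \<longrightarrow> f (t - s) \<ge> \<eta> - \<epsilon>) at_top"
        using s(1) eps unfolding D_def by blast
      have "\<bar>f (t - s) - f (t - x)\<bar> < \<epsilon>" for t by (rule r) (use s in simp)
      then have "f (t - s) - f (t - x) < \<epsilon>" for t by (simp add: abs_less_iff)
      then have "eventually (\<lambda>t. f t \<ge> \<eta> - \<delta> \<longrightarrow> f (t - x) \<ge> \<eta> - 2 * \<epsilon>) at_top"
        using ev by (auto elim!: eventually_mono) (smt (verit))
      with \<delta> show ?thesis by blast
    qed
    obtain N where N: "real N * \<epsilon> > 2 * B" using eps reals_Archimedean3 by blast
    have "\<forall>k. \<exists>\<delta>>0. eventually (\<lambda>t. f t \<ge> \<eta> - \<delta> \<longrightarrow> f (t - (A + real k * c)) \<ge> \<eta> - 2 * \<epsilon>) at_top"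
      using c by (auto intro!: reach)
    then obtain \<delta> where \<delta>: "\<And>k. \<delta> k > 0" and
      ev: "\<And>k. eventually (\<lambda>t. f t \<ge> \<eta> - \<delta> k \<longrightarrow> f (t - (A + real k * c)) \<ge> \<eta> - 2 * \<epsilon>) at_top"
      by metis
    define d where "d = Min (\<delta> ` {..N})"
    have d: "d > 0" unfolding d_def using \<delta> by (subst Min_gr_iff) auto
    have d_le: "d \<le> \<delta> k" if "k \<le> N" for k unfolding d_def using that by (intro Min_le) auto
    have "eventually (\<lambda>t. \<forall>k\<in>{..N}. f t \<ge> \<eta> - \<delta> k \<longrightarrow> f (t - (A + real k * c)) \<ge> \<eta> - 2 * \<epsilon>) at_top"
      using ev by (intro eventually_ball_finite) auto
    from frequently_eventually_frequently[OF freq[OF d] this] frequently_ex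
    obtain t where "f t \<ge> \<eta> - d"
      "\<forall>k\<in>{..N}. f t \<ge> \<eta> - \<delta> k \<longrightarrow> f (t - (A + real k * c)) \<ge> \<eta> - 2 * \<epsilon>" by blast
    then have t: "f (t - (A + real k * c)) \<ge> \<eta> - 2 * \<epsilon>" if "k \<le> N" for k
      using d_le[OF that] that by force
    have telescope: "(\<Sum>k<n. f (t - (A + real k * c))) = G (t - A) - G (t - A - real n * c)" for n
      by (induction n) (auto simp: f_def algebra_simps)
    have "real N * (\<eta> - 2 * \<epsilon>) = (\<Sum>k<N. \<eta> - 2 * \<epsilon>)" by simp
    also have "\<dots> \<le> (\<Sum>k<N. f (t - (A + real k * c)))" by (intro sum_mono t) auto
    also have "\<dots> \<le> 2 * B"
      unfolding telescope using bounded[of "t - A"] bounded[of "t - A - real N * c"] by simp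
    finally have "real N * (\<eta> - 2 * \<epsilon>) < real N * \<epsilon>" using N by simp
    then have "\<eta> - 2 * \<epsilon> < \<epsilon>" by (simp add: mult_less_cancel_left)
    then show ?thesis by simp
  qed
  from this[of "e / 9"] have "\<eta> + e / 2 < e" using e by simp
  moreover have "eventually (\<lambda>t. f t \<le> \<eta> + e / 2) at_top" using upper e by simp
  ultimately show ?thesis unfolding f_def by (auto elim: eventually_mono)
qed

text \<open>
  The hypotheses are invariant under \<open>G \<mapsto> - G\<close>, so the one-sided estimate gives both bounds.
\<close>

lemma increment_tendsto_0:
  fixes G :: "real \<Rightarrow> real"
  assumes F: "real_distribution F" and nonneg: "AE x in F. x \<ge> 0" and na: "nonarithmetic F"
    and bounded: "\<And>x. \<bar>G x\<bar> \<le> B" and uc: "uniformly_continuous_on UNIV G"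
    and harmonic: "((\<lambda>t. G t - (\<integral>y. G (t - y) \<partial>F)) \<longlongrightarrow> 0) at_top"
    and c: "c \<ge> 0"
  shows "((\<lambda>t. G t - G (t - c)) \<longlongrightarrow> 0) at_top"
proof (rule order_tendstoI)
  fix e :: real assume "0 < e"
  then show "eventually (\<lambda>t. G t - G (t - c) < e) at_top"
    by (intro increment_limsup_nonpos[OF F nonneg na bounded uc harmonic c])
next
  fix e :: real assume e: "e < 0"
  have "((\<lambda>t. - G t - (\<integral>y. - G (t - y) \<partial>F)) \<longlongrightarrow> 0) at_top"
    using tendsto_minus[OF harmonic] by simp
  then have "eventually (\<lambda>t. - G t - - G (t - c) < - e) at_top"
    using e bounded by (intro increment_limsup_nonpos[OF F nonneg na, of _ B])
      (auto intro!: uniformly_continuous_on_minus uc c)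
  then show "eventually (\<lambda>t. e < G t - G (t - c)) at_top" by (rule eventually_mono) simp
qed

section \<open>Consequences of the renewal equation\<close>

text \<open>
  Here \<open>F\<close> is the law of the increments, \<open>P0\<close> that of the first epoch, and \<open>W\<close> the expected number of
  epochs. Everything about \<open>W\<close> is drawn from the convolution equation \<open>W = P0 + W * F\<close> and local
  finiteness, without reference to the underlying random walk.
\<close>

locale renewal_equation = F: real_distribution F + P0: real_distribution P0
  for F P0 :: "real measure" +
  fixes W :: "real measure"
  assumes sets_W [measurable_cong]: "sets W = sets borel"
    and F_nonneg: "AE x in F. x \<ge> 0"
    and F_nonarithmetic: "nonarithmetic F"
    and F_integrable: "integrable F (\<lambda>x. x)"
    and F_mean_pos: "(\<integral>x. x \<partial>F) > 0"
    and W_finite: "\<And>t. emeasure W {..t} < \<infinity>"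
    and renewal: "\<And>f. f \<in> borel_measurable borel \<Longrightarrow>
      (\<integral>\<^sup>+x. f x \<partial>W) = (\<integral>\<^sup>+x. f x \<partial>P0) + (\<integral>\<^sup>+x. (\<integral>\<^sup>+y. f (x + y) \<partial>F) \<partial>W)"
begin

lemma space_W [simp]: "space W = UNIV"
  using sets_eq_imp_space_eq[OF sets_W] by simp

lemma sigma_finite_W: "sigma_finite_measure W"
proof
  show "\<exists>A. countable A \<and> A \<subseteq> sets W \<and> \<Union>A = space W \<and> (\<forall>a\<in>A. emeasure W a \<noteq> \<infinity>)"
  proof (intro exI[of _ "range (\<lambda>n::nat. {..real n})"] conjI)
    show "\<Union>(range (\<lambda>n::nat. {..real n})) = space W"
      using real_arch_simple by auto
  qed (use W_finite in \<open>auto simp: sets_W less_top[symmetric]\<close>)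
qed

lemma W_interval_finite: "emeasure W {a<..b} < \<infinity>"
proof -
  have "emeasure W {a<..b} \<le> emeasure W {..b}" by (rule emeasure_mono) (auto simp: sets_W)
  then show ?thesis using W_finite by (rule le_less_trans)
qed

sublocale WF: pair_sigma_finite W F
  using sigma_finite_W F.sigma_finite_measure_axioms by (rule pair_sigma_finite.intro)

sublocale WL: pair_sigma_finite W lborel
  using sigma_finite_W sigma_finite_lborel by (rule pair_sigma_finite.intro)

lemma tail_measurable: "(\<lambda>x. emeasure F {x<..}) \<in> borel_measurable borel"
proof -
  have "(\<lambda>x. \<integral>\<^sup>+y. indicator {p. fst p < snd p} (x, y) \<partial>F) \<in> borel_measurable borel"
    by measurable
  also have "(\<lambda>x. \<integral>\<^sup>+y. indicator {p. fst p < snd p} (x, y) \<partial>F) = (\<lambda>x. emeasure F {x<..})"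
    by (auto simp: nn_integral_indicator[symmetric] indicator_def fun_eq_iff
        simp del: nn_integral_indicator intro!: nn_integral_cong)
  finally show ?thesis .
qed

text \<open>
  If the first epoch is at most \<open>t\<close>, there is almost surely a last one in \<open>{..t}\<close>: the integrand is the
  probability that an epoch at \<open>x\<close> is followed by an increment leaping over \<open>t\<close>. Analytically, this is the
  renewal equation on \<open>{..t}\<close> with the finite quantity \<open>(W * F) {..t}\<close> cancelled.
\<close>

lemma tail_identity:
  "(\<integral>\<^sup>+x. indicator {..t} x * emeasure F {t - x<..} \<partial>W) = emeasure P0 {..t}"
proof -
  have [measurable]: "(\<lambda>x. emeasure F {t - x<..}) \<in> borel_measurable borel"
    by (rule measurable_compose[OF _ tail_measurable]) measurable
  define B where "B = (\<integral>\<^sup>+x. (\<integral>\<^sup>+y. indicator {..t} (x + y) \<partial>F) \<partial>W)"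
  have W_eq: "emeasure W {..t} = emeasure P0 {..t} + B"
    using renewal[of "indicator {..t}"] by (simp add: B_def sets_W)
  then have "B < \<infinity>" using W_finite[of t] by (auto simp: less_top)
  have split: "(indicator {..t} x :: ennreal) =
      indicator {..t} x * emeasure F {t - x<..} + (\<integral>\<^sup>+y. indicator {..t} (x + y) \<partial>F)" for x
  proof (cases "x \<le> t")
    case True
    have "(\<integral>\<^sup>+y. indicator {..t} (x + y) \<partial>F) = (\<integral>\<^sup>+y. indicator {..t - x} y \<partial>F)"
      by (intro nn_integral_cong) (auto simp: indicator_def)
    also have "\<dots> = emeasure F {..t - x}" by simp
    finally have "indicator {..t} x * emeasure F {t - x<..} + (\<integral>\<^sup>+y. indicator {..t} (x + y) \<partial>F)
        = emeasure F {t - x<..} + emeasure F {..t - x}" using True by simp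
    also have "\<dots> = emeasure F ({t - x<..} \<union> {..t - x})"
      by (intro plus_emeasure) auto
    also have "{t - x<..} \<union> {..t - x} = space F" by auto
    finally show ?thesis using True F.emeasure_space_1 by simp
  next
    case False
    have "(\<integral>\<^sup>+y. indicator {..t} (x + y) \<partial>F) = (\<integral>\<^sup>+y. 0 \<partial>F)"
      by (intro nn_integral_cong_AE, use F_nonneg in eventually_elim)
        (use False in \<open>auto simp: indicator_def\<close>)
    then show ?thesis using False by simp
  qed
  have "emeasure W {..t} = (\<integral>\<^sup>+x. indicator {..t} x \<partial>W)" by (simp add: sets_W)
  also have "\<dots> = (\<integral>\<^sup>+x. indicator {..t} x * emeasure F {t - x<..} + (\<integral>\<^sup>+y. indicator {..t} (x + y) \<partial>F) \<partial>W)"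
    by (subst split) simp
  also have "\<dots> = (\<integral>\<^sup>+x. indicator {..t} x * emeasure F {t - x<..} \<partial>W) + B"
    unfolding B_def by (rule nn_integral_add) measurable
  finally have "B + (\<integral>\<^sup>+x. indicator {..t} x * emeasure F {t - x<..} \<partial>W) = B + emeasure P0 {..t}"
    using W_eq by (simp only: add.commute)
  then show ?thesis 
    using \<open>B < \<infinity>\<close> by (metis ennreal_add_left_cancel infinity_ennreal_def less_irrefl)
qed

lemma tail_positive: "\<exists>h>0. measure F {h<..} > 0"
proof (rule ccontr)
  assume "\<not> ?thesis"
  then have null: "measure F {h<..} = 0" if "h > 0" for h

    using that measure_nonneg[of F "{h<..}"] by (metis less_eq_real_def)
  have "AE x in F. \<forall>n. x \<le> inverse (real (Suc n))"
    unfolding AE_all_countable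
  proof
    fix n
    have "{inverse (real (Suc n))<..} \<in> null_sets F"
      using null[of "inverse (real (Suc n))"] by (simp add: null_sets_def F.emeasure_eq_measure)
    then show "AE x in F. x \<le> inverse (real (Suc n))"
      by (rule AE_I') auto
  qed
  then have "AE x in F. x \<le> 0"
  proof eventually_elim
    case (elim x)
    show ?case
    proof (rule ccontr)
      assume "\<not> x \<le> 0"
      then obtain n where "inverse (real (Suc n)) < x" using reals_Archimedean[of x] by auto
      with elim show False by (meson not_le)
    qed
  qed
  then have "(\<integral>x. x \<partial>F) \<le> (\<integral>x. 0 \<partial>F)"
    by (intro integral_mono_AE F_integrable) auto
  with F_mean_pos show False by simp
qed

text \<open>
  If \<open>q = F {h0<..}\<close> is positive, the tail identity at \<open>t\<close> shows \<open>q W {t - h0<..t} \<le> 1\<close>. Longer windows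
  are covered by windows of length \<open>h0\<close>, whose number is affine in \<open>h\<close>.
\<close>

lemma W_interval_bound: "\<exists>C\<ge>0. \<forall>t h. h \<ge> 0 \<longrightarrow> emeasure W {t - h<..t} \<le> ennreal (C * (1 + h))"
proof -
  obtain h0 where h0: "h0 > 0" "measure F {h0<..} > 0" using tail_positive by blast
  define q where "q = measure F {h0<..}"
  have q: "q > 0" using h0 by (simp add: q_def)
  have short: "emeasure W {t - h0<..t} \<le> ennreal (1 / q)" for t
  proof -
    have "ennreal q * emeasure W {t - h0<..t} = (\<integral>\<^sup>+x. ennreal q * indicator {t - h0<..t} x \<partial>W)"
      by (simp add: nn_integral_cmult sets_W)
    also have "\<dots> \<le> (\<integral>\<^sup>+x. indicator {..t} x * emeasure F {t - x<..} \<partial>W)"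
    proof (rule nn_integral_mono)
      fix x
      have "emeasure F {h0<..} \<le> emeasure F {t - x<..}" if "t - h0 < x"
        by (rule emeasure_mono) (use that in auto)
      then show "ennreal q * indicator {t - h0<..t} x \<le> indicator {..t} x * emeasure F {t - x<..}"
        by (auto simp: indicator_def q_def F.emeasure_eq_measure)
    qed
    also have "\<dots> \<le> 1" unfolding tail_identity using P0.emeasure_le_1 by simp
    finally have *: "ennreal q * emeasure W {t - h0<..t} \<le> 1" .
    have "emeasure W {t - h0<..t} = ennreal (1 / q) * (ennreal q * emeasure W {t - h0<..t})"
      using q by (simp add: mult.assoc[symmetric] ennreal_mult[symmetric])
    also have "\<dots> \<le> ennreal (1 / q) * 1" by (intro mult_left_mono *) simp
    finally show ?thesis by simp
  qed
  define C where "C = (1 + 1 / h0) * (1 / q)"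
  have "emeasure W {t - h<..t} \<le> ennreal (C * (1 + h))" if h: "h \<ge> 0" for t h
  proof -
    define N where "N = nat \<lceil>h / h0\<rceil>"
    have N: "h / h0 \<le> real N" "real N \<le> h / h0 + 1"
      unfolding N_def using h h0 by (auto simp: of_nat_nat ceiling_correct le_nat_iff)
    have "{t - h<..t} \<subseteq> (\<Union>k<N. {t - real k * h0 - h0<..t - real k * h0})"
    proof
      fix x assume x: "x \<in> {t - h<..t}"
      define k where "k = nat \<lfloor>(t - x) / h0\<rfloor>"
      have "(t - x) / h0 \<ge> 0" using x h0 by simp
      then have "real k = of_int \<lfloor>(t - x) / h0\<rfloor>" by (simp add: k_def)
      then have k: "real k \<le> (t - x) / h0" "(t - x) / h0 < real k + 1" by linarith+
      have "(t - x) / h0 < h / h0" using x h0 by (intro divide_strict_right_mono) auto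
      then have "real k < real N" using k N by linarith
      then show "x \<in> (\<Union>k<N. {t - real k * h0 - h0<..t - real k * h0})"
        using k h0 by (auto simp: field_simps intro!: bexI[of _ k])
    qed
    then have "emeasure W {t - h<..t} \<le> emeasure W (\<Union>k<N. {t - real k * h0 - h0<..t - real k * h0})"
      by (rule emeasure_mono) (auto simp: sets_W)
    also have "\<dots> \<le> (\<Sum>k<N. emeasure W {t - real k * h0 - h0<..t - real k * h0})"
      by (rule emeasure_subadditive_finite) (auto simp: sets_W)
    also have "\<dots> \<le> (\<Sum>k<N. ennreal (1 / q))" by (intro sum_mono short)
    also have "\<dots> = ennreal (real N * (1 / q))"
      using q by (subst ennreal_mult) (auto simp: ennreal_of_nat_eq_real_of_nat)
    also have "\<dots> \<le> ennreal (C * (1 + h))"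
    proof (rule ennreal_leI)
      have "h / h0 + 1 \<le> (1 + 1 / h0) * (1 + h)" using h h0 by (simp add: field_simps)
      with N have "real N \<le> (1 + 1 / h0) * (1 + h)" by linarith
      then have "real N * (1 / q) \<le> ((1 + 1 / h0) * (1 + h)) * (1 / q)"
        using q by (intro mult_right_mono) auto
      then show "real N * (1 / q) \<le> C * (1 + h)" by (simp only: C_def mult.assoc mult.commute[of "1 + h"])
    qed
    finally show ?thesis .
  qed
  moreover have "C \<ge> 0" using h0 q by (simp add: C_def)
  ultimately show ?thesis by blast
qed

lemma tail_integral: "(\<integral>\<^sup>+x. indicator {0..} x * emeasure F {x<..} \<partial>lborel) = ennreal (\<integral>x. x \<partial>F)"
proof -
  interpret FL: pair_sigma_finite F lborel
    using F.sigma_finite_measure_axioms sigma_finite_lborel by (rule pair_sigma_finite.intro)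
  have "(\<integral>\<^sup>+x. indicator {0..} x * emeasure F {x<..} \<partial>lborel)
      = (\<integral>\<^sup>+x. (\<integral>\<^sup>+y. indicator {0..} x * indicator {p. fst p < snd p} (x, y) \<partial>F) \<partial>lborel)"
    by (intro nn_integral_cong, subst nn_integral_cmult)
      (auto simp: nn_integral_indicator[symmetric] indicator_def
        simp del: nn_integral_indicator intro!: nn_integral_cong)
  also have "\<dots> = (\<integral>\<^sup>+y. (\<integral>\<^sup>+x. indicator {0..} x * indicator {p. fst p < snd p} (x, y) \<partial>lborel) \<partial>F)"
    by (rule FL.Fubini') measurable
  also have "\<dots> = (\<integral>\<^sup>+y. emeasure lborel {0..<y} \<partial>F)"
    by (auto simp: nn_integral_indicator[symmetric] indicator_def
        simp del: nn_integral_indicator intro!: nn_integral_cong)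
  also have "\<dots> = (\<integral>\<^sup>+y. ennreal y \<partial>F)"
    by (intro nn_integral_cong_AE, use F_nonneg in eventually_elim) simp
  also have "\<dots> = ennreal (\<integral>x. x \<partial>F)"
    by (rule nn_integral_eq_integral) (use F_integrable F_nonneg in auto)
  finally show ?thesis .
qed

definition smoothed :: "(real \<Rightarrow> real) \<Rightarrow> real \<Rightarrow> real" where
  "smoothed \<phi> t = (\<integral>y. \<phi> (t - y) \<partial>W)"

context
  fixes \<phi> :: "real \<Rightarrow> real" and m :: real
  assumes \<phi>_uc: "uniformly_continuous_on UNIV \<phi>"
    and \<phi>_nonneg: "\<And>x. 0 \<le> \<phi> x" and \<phi>_le_1: "\<And>x. \<phi> x \<le> 1"
    and \<phi>_support: "\<And>x. \<bar>x\<bar> \<ge> m \<Longrightarrow> \<phi> x = 0" and m: "m > 0"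
begin

lemma \<phi>_measurable: "\<phi> \<in> borel_measurable borel"
  by (intro borel_measurable_continuous_onI uniformly_continuous_imp_continuous \<phi>_uc)

lemma \<phi>_integrable_W: "integrable W (\<lambda>y. \<phi> (t - y))"
proof (rule Bochner_Integration.integrable_bound[of W "\<lambda>y. indicator {t - m<..t + m} y :: real"])
  note [measurable] = \<phi>_measurable
  show "(\<lambda>y. \<phi> (t - y)) \<in> borel_measurable W" by measurable
  show "integrable W (\<lambda>y. indicator {t - m<..t + m} y :: real)"
    using W_interval_finite by (simp add: sets_W)
  show "AE y in W. norm (\<phi> (t - y)) \<le> norm (indicator {t - m<..t + m} y :: real)"
  proof (rule AE_I2)
    fix y
    show "norm (\<phi> (t - y)) \<le> norm (indicator {t - m<..t + m} y :: real)"
      using \<phi>_support[of "t - y"] \<phi>_nonneg[of "t - y"] \<phi>_le_1[of "t - y"]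
      by (cases "\<bar>t - y\<bar> \<ge> m") (auto simp: indicator_def)
  qed
qed

lemma smoothed_nonneg: "smoothed \<phi> t \<ge> 0"
  unfolding smoothed_def using \<phi>_nonneg by simp

lemma smoothed_bounded: "\<exists>B. \<forall>t. \<bar>smoothed \<phi> t\<bar> \<le> B"
proof -
  obtain C where C: "C \<ge> 0" "\<And>t h. h \<ge> 0 \<Longrightarrow> emeasure W {t - h<..t} \<le> ennreal (C * (1 + h))"
    using W_interval_bound by blast
  have "\<bar>smoothed \<phi> t\<bar> \<le> C * (1 + 2 * m)" for t
  proof -
    have "smoothed \<phi> t \<le> (\<integral>y. indicator {t - m<..t + m} y \<partial>W)"
      unfolding smoothed_def
    proof (rule integral_mono[OF \<phi>_integrable_W])
      show "integrable W (\<lambda>y. indicator {t - m<..t + m} y :: real)"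
        using W_interval_finite by (simp add: sets_W)
      fix y
      show "\<phi> (t - y) \<le> indicator {t - m<..t + m} y"
        using \<phi>_support[of "t - y"] \<phi>_le_1[of "t - y"]
        by (cases "\<bar>t - y\<bar> \<ge> m") (auto simp: indicator_def)
    qed
    also have "\<dots> = measure W {t - m<..t + m}" by simp
    also have "\<dots> \<le> C * (1 + 2 * m)"
      using C(2)[of "2 * m" "t + m"] C(1) m unfolding measure_def
      by (intro enn2real_leI) (auto simp: algebra_simps)
    finally show ?thesis using smoothed_nonneg[of t] by simp
  qed
  then show ?thesis by blast
qed

lemma smoothed_uniformly_continuous: "uniformly_continuous_on UNIV (smoothed \<phi>)"
proof -
  obtain C where C: "C \<ge> 0" "\<And>t h. h \<ge> 0 \<Longrightarrow> emeasure W {t - h<..t} \<le> ennreal (C * (1 + h))"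
    using W_interval_bound by blast
  define K where "K = C * (1 + 2 * (m + 1)) + 1"
  have K: "K > 0" using C m by (auto simp: K_def intro!: add_nonneg_pos)
  show ?thesis
    unfolding uniformly_continuous_on_def dist_real_def
  proof (intro allI impI)
    fix e :: real assume e: "e > 0"
    obtain r where r: "r > 0" "\<And>x y. \<bar>x - y\<bar> < r \<Longrightarrow> \<bar>\<phi> x - \<phi> y\<bar> < e / K"
      using \<phi>_uc e K unfolding uniformly_continuous_on_def dist_real_def
      by (metis UNIV_I divide_pos_pos)
    have "\<bar>smoothed \<phi> s - smoothed \<phi> t\<bar> < e" if st: "\<bar>s - t\<bar> < min r 1" for s t
    proof -
      have int: "integrable W (\<lambda>y. e / K * indicator {t - (m + 1)<..t + (m + 1)} y :: real)"
        using W_interval_finite by (simp add: sets_W)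
      have "\<bar>smoothed \<phi> s - smoothed \<phi> t\<bar> = \<bar>\<integral>y. \<phi> (s - y) - \<phi> (t - y) \<partial>W\<bar>"
        unfolding smoothed_def by (subst Bochner_Integration.integral_diff) (auto intro: \<phi>_integrable_W)
      also have "\<dots> \<le> (\<integral>y. \<bar>\<phi> (s - y) - \<phi> (t - y)\<bar> \<partial>W)"
        by (rule integral_abs_bound)
      also have "\<dots> \<le> (\<integral>y. e / K * indicator {t - (m + 1)<..t + (m + 1)} y \<partial>W)"
      proof (rule integral_mono[OF _ int])
        fix y
        have "\<bar>\<phi> (s - y) - \<phi> (t - y)\<bar> < e / K" by (rule r) (use st in auto)
        moreover have "\<phi> (s - y) = 0" "\<phi> (t - y) = 0" if "y \<notin> {t - (m + 1)<..t + (m + 1)}"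
          using that st by (auto intro!: \<phi>_support)
        ultimately show "\<bar>\<phi> (s - y) - \<phi> (t - y)\<bar> \<le> e / K * indicator {t - (m + 1)<..t + (m + 1)} y"
          by (cases "y \<in> {t - (m + 1)<..t + (m + 1)}") auto
      qed (intro integrable_abs Bochner_Integration.integrable_diff \<phi>_integrable_W)
      also have "\<dots> = e / K * measure W {t - (m + 1)<..t + (m + 1)}" by simp
      also have "\<dots> \<le> e / K * (K - 1)"
      proof (rule mult_left_mono)
        show "measure W {t - (m + 1)<..t + (m + 1)} \<le> K - 1"
          using C(2)[of "2 * (m + 1)" "t + (m + 1)"] C(1) m unfolding measure_def K_def
          by (intro enn2real_leI) (auto simp: algebra_simps)
      qed (use e K in simp)
      also have "\<dots> < e" using e K by (simp add: field_simps)
      finally show ?thesis .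
    qed
    then show "\<exists>d>0. \<forall>x\<in>UNIV. \<forall>x'\<in>UNIV. \<bar>x' - x\<bar> < d \<longrightarrow> \<bar>smoothed \<phi> x' - smoothed \<phi> x\<bar> < e"
      using r by (intro exI[of _ "min r 1"]) auto
  qed
qed

lemma smoothed_measurable: "smoothed \<phi> \<in> borel_measurable borel"
  by (intro borel_measurable_continuous_onI uniformly_continuous_imp_continuous
      smoothed_uniformly_continuous)

lemma nn_integral_smoothed: "(\<integral>\<^sup>+y. ennreal (\<phi> (t - y)) \<partial>W) = ennreal (smoothed \<phi> t)"
  unfolding smoothed_def by (rule nn_integral_eq_integral) (auto intro: \<phi>_integrable_W \<phi>_nonneg)

lemma smoothed_renewal:
  "smoothed \<phi> t = (\<integral>x. \<phi> (t - x) \<partial>P0) + (\<integral>y. smoothed \<phi> (t - y) \<partial>F)"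
proof -
  note [measurable] = \<phi>_measurable smoothed_measurable
  obtain B where B: "\<And>t. \<bar>smoothed \<phi> t\<bar> \<le> B" using smoothed_bounded by blast
  have "ennreal (smoothed \<phi> t) = (\<integral>\<^sup>+x. ennreal (\<phi> (t - x)) \<partial>P0) +
      (\<integral>\<^sup>+x. (\<integral>\<^sup>+y. ennreal (\<phi> (t - (x + y))) \<partial>F) \<partial>W)"
    unfolding nn_integral_smoothed[symmetric] by (rule renewal) measurable
  also have "(\<integral>\<^sup>+x. (\<integral>\<^sup>+y. ennreal (\<phi> (t - (x + y))) \<partial>F) \<partial>W)
      = (\<integral>\<^sup>+y. (\<integral>\<^sup>+x. ennreal (\<phi> (t - (x + y))) \<partial>W) \<partial>F)"
    by (rule WF.Fubini'[symmetric]) measurable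
  also have "\<dots> = (\<integral>\<^sup>+y. ennreal (smoothed \<phi> (t - y)) \<partial>F)"
    by (simp add: nn_integral_smoothed[symmetric] algebra_simps)
  also have "\<dots> = ennreal (\<integral>y. smoothed \<phi> (t - y) \<partial>F)"
    by (intro nn_integral_eq_integral F.integrable_const_bound[of _ B])
      (use B in \<open>auto simp: smoothed_nonneg abs_le_iff\<close>)
  also have "(\<integral>\<^sup>+x. ennreal (\<phi> (t - x)) \<partial>P0) = ennreal (\<integral>x. \<phi> (t - x) \<partial>P0)"
    by (intro nn_integral_eq_integral P0.integrable_const_bound[of _ 1])
      (auto simp: \<phi>_nonneg \<phi>_le_1)
  finally show ?thesis
    using smoothed_nonneg \<phi>_nonneg by (simp add: ennreal_plus[symmetric] del: ennreal_plus)
qed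

text \<open>
  The defect of harmonicity of \<open>smoothed \<phi>\<close> is the \<open>P0\<close>-average of \<open>\<phi> (t - x)\<close>; it vanishes in the limit
  since \<open>\<phi>\<close> has bounded support.
\<close>

lemma smoothed_increment_tendsto_0:
  assumes "c \<ge> 0"
  shows "((\<lambda>t. smoothed \<phi> t - smoothed \<phi> (t - c)) \<longlongrightarrow> 0) at_top"
proof -
  note [measurable] = \<phi>_measurable smoothed_measurable
  obtain B where B: "\<And>t. \<bar>smoothed \<phi> t\<bar> \<le> B" using smoothed_bounded by blast
  have "((\<lambda>t. \<integral>x. \<phi> (t - x) \<partial>P0) \<longlongrightarrow> (\<integral>x. 0 \<partial>P0)) at_top"
  proof (rule integral_dominated_convergence_at_top[where w = "\<lambda>_. 1"])
    show "AE x in P0. ((\<lambda>t. \<phi> (t - x)) \<longlongrightarrow> 0) at_top"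
    proof (rule AE_I2)
      fix x
      have "eventually (\<lambda>t. \<phi> (t - x) = 0) at_top"
        using eventually_ge_at_top[of "x + m"] by eventually_elim (auto intro: \<phi>_support)
      then show "((\<lambda>t. \<phi> (t - x)) \<longlongrightarrow> 0) at_top" by (rule tendsto_eventually)
    qed
  qed (auto simp: \<phi>_nonneg \<phi>_le_1)
  then have "((\<lambda>t. smoothed \<phi> t - (\<integral>y. smoothed \<phi> (t - y) \<partial>F)) \<longlongrightarrow> 0) at_top"
    by (subst smoothed_renewal) simp
  then show ?thesis
    by (intro increment_tendsto_0[OF F.real_distribution_axioms F_nonneg F_nonarithmetic B
          smoothed_uniformly_continuous] assms)
qed

text \<open>
  This is the convolution of \<open>tail_identity\<close> with \<open>\<phi>\<close>, after an exchange of integrals. It is the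
  relation that will determine the value of the limit.
\<close>

lemma smoothed_tail_identity:
  "(\<integral>\<^sup>+x. indicator {0..} x * emeasure F {x<..} * ennreal (smoothed \<phi> (t - x)) \<partial>lborel)
    = (\<integral>\<^sup>+u. ennreal (\<phi> u) * emeasure P0 {..t - u} \<partial>lborel)"
proof -
  note [measurable] = \<phi>_measurable smoothed_measurable tail_measurable
  have "(\<integral>\<^sup>+x. indicator {0..} x * emeasure F {x<..} * ennreal (smoothed \<phi> (t - x)) \<partial>lborel)
    = (\<integral>\<^sup>+x. (\<integral>\<^sup>+y. indicator {0..} x * emeasure F {x<..} * ennreal (\<phi> (t - x - y)) \<partial>W) \<partial>lborel)"
    by (subst nn_integral_cmult) (auto simp: nn_integral_smoothed)
  also have "\<dots> = (\<integral>\<^sup>+y. (\<integral>\<^sup>+x. indicator {0..} x * emeasure F {x<..} * ennreal (\<phi> (t - x - y)) \<partial>lborel) \<partial>W)"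
    by (rule WL.Fubini') measurable
  also have "\<dots> = (\<integral>\<^sup>+y. (\<integral>\<^sup>+u. ennreal (\<phi> u) * (indicator {..t - u} y * emeasure F {t - u - y<..}) \<partial>lborel) \<partial>W)"
  proof (rule nn_integral_cong)
    fix y
    have "(\<integral>\<^sup>+x. indicator {0..} x * emeasure F {x<..} * ennreal (\<phi> (t - x - y)) \<partial>lborel)
      = (\<integral>\<^sup>+u. indicator {0..} (t - y + - 1 * u) * emeasure F {t - y + - 1 * u<..} *
          ennreal (\<phi> (t - (t - y + - 1 * u) - y)) \<partial>lborel)"
      by (subst nn_integral_real_affine[where c = "- 1" and t = "t - y"]) auto
    also have "\<dots> = (\<integral>\<^sup>+u. ennreal (\<phi> u) * (indicator {..t - u} y * emeasure F {t - u - y<..}) \<partial>lborel)"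
      by (intro nn_integral_cong) (auto simp: indicator_def algebra_simps)
    finally show "(\<integral>\<^sup>+x. indicator {0..} x * emeasure F {x<..} * ennreal (\<phi> (t - x - y)) \<partial>lborel) = \<dots>" .
  qed
  also have "\<dots> = (\<integral>\<^sup>+u. (\<integral>\<^sup>+y. ennreal (\<phi> u) * (indicator {..t - u} y * emeasure F {t - u - y<..}) \<partial>W) \<partial>lborel)"
  proof (rule WL.Fubini'[symmetric])
    have "(\<lambda>p. ennreal (\<phi> (snd p)) * (indicator {p. snd p \<le> t - fst p} (snd p, fst p) * emeasure F {t - snd p - fst p<..}))
       \<in> borel_measurable (W \<Otimes>\<^sub>M lborel)" by measurable
    then show "(\<lambda>(y, u). ennreal (\<phi> u) * (indicator {..t - u} y * emeasure F {t - u - y<..}))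
       \<in> borel_measurable (W \<Otimes>\<^sub>M lborel)"
      by (rule measurable_cong[THEN iffD1, rotated]) (auto simp: indicator_def)
  qed
  also have "\<dots> = (\<integral>\<^sup>+u. ennreal (\<phi> u) * emeasure P0 {..t - u} \<partial>lborel)"
  proof (rule nn_integral_cong)
    fix u
    show "(\<integral>\<^sup>+y. ennreal (\<phi> u) * (indicator {..t - u} y * emeasure F {t - u - y<..}) \<partial>W)
      = ennreal (\<phi> u) * emeasure P0 {..t - u}"
      by (subst nn_integral_cmult) (auto simp: tail_identity)
  qed
  finally show ?thesis .
qed

lemma \<phi>_integrable_lborel: "integrable lborel \<phi>"
proof (rule Bochner_Integration.integrable_bound[of lborel "\<lambda>y. indicator {- m..m} y :: real"])
  show "\<phi> \<in> borel_measurable lborel" using \<phi>_measurable by simp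
  show "integrable lborel (\<lambda>y. indicator {- m..m} y :: real)" using m by simp
  show "AE y in lborel. norm (\<phi> y) \<le> norm (indicator {- m..m} y :: real)"
  proof (rule AE_I2)
    fix y
    show "norm (\<phi> y) \<le> norm (indicator {- m..m} y :: real)"
      using \<phi>_support[of y] \<phi>_nonneg[of y] \<phi>_le_1[of y]
      by (cases "\<bar>y\<bar> \<ge> m") (auto simp: indicator_def)
  qed
qed

text \<open>
  As \<open>t\<close> grows, the right-hand side of \<open>smoothed_tail_identity\<close> tends to the integral of \<open>\<phi>\<close>. On the
  left, the increments of \<open>smoothed \<phi>\<close> tend to 0, so \<open>smoothed \<phi> (t - x)\<close> may be replaced by
  \<open>smoothed \<phi> t\<close>; the remaining factor is the integrated tail of \<open>F\<close>, which is the mean.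
\<close>

lemma smoothed_tendsto:
  "(smoothed \<phi> \<longlongrightarrow> (\<integral>u. \<phi> u \<partial>lborel) / (\<integral>x. x \<partial>F)) at_top"
proof -
  note [measurable] = \<phi>_measurable smoothed_measurable
  obtain B where B: "\<And>t. \<bar>smoothed \<phi> t\<bar> \<le> B" using smoothed_bounded by blast
  define \<mu> where "\<mu> = (\<integral>x. x \<partial>F)"
  have \<mu>: "\<mu> > 0" using F_mean_pos by (simp add: \<mu>_def)
  define k where "k x = indicator {0..} x * measure F {x<..}" for x
  have [measurable]: "(\<lambda>x. measure F {x<..}) \<in> borel_measurable borel"
    unfolding measure_def using tail_measurable by measurable
  have k_meas [measurable]: "k \<in> borel_measurable borel" unfolding k_def by measurable
  have k_nonneg: "k x \<ge> 0" for x by (simp add: k_def)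
  have k_ennreal: "ennreal (k x) = indicator {0..} x * emeasure F {x<..}" for x
    by (simp add: k_def F.emeasure_eq_measure indicator_def)
  have k_int: "(\<integral>\<^sup>+x. ennreal (k x) \<partial>lborel) = ennreal \<mu>"
    unfolding k_ennreal \<mu>_def by (rule tail_integral)
  have k_integrable: "integrable lborel k"
    by (rule integrableI_nn_integral_finite[OF _ _ k_int]) (auto simp: k_nonneg)
  have k_integral: "(\<integral>x. k x \<partial>lborel) = \<mu>"
    using k_int \<mu> by (intro integral_eq_nn_integral[THEN trans]) (auto simp: k_nonneg)
  have kG_integrable: "integrable lborel (\<lambda>x. k x * smoothed \<phi> (t - x))" for t
  proof (rule Bochner_Integration.integrable_bound[of lborel "\<lambda>x. B * k x"])
    show "AE x in lborel. norm (k x * smoothed \<phi> (t - x)) \<le> norm (B * k x)"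
    proof (rule AE_I2)
      fix x
      have "\<bar>k x * smoothed \<phi> (t - x)\<bar> \<le> k x * B"
        using B[of "t - x"] k_nonneg[of x] by (simp add: abs_mult mult_left_mono)
      then show "norm (k x * smoothed \<phi> (t - x)) \<le> norm (B * k x)" by (simp add: mult.commute)
    qed
  qed (use k_integrable in auto)
  have conv: "(\<integral>x. k x * smoothed \<phi> (t - x) \<partial>lborel) = (\<integral>u. \<phi> u * cdf P0 (t - u) \<partial>lborel)" for t
  proof -
    have "(\<lambda>u. cdf P0 (t - u)) \<in> borel_measurable borel"
      by (rule measurable_compose[where f = "\<lambda>u. t - u" and g = "cdf P0" and N = borel])
        (auto intro!: borel_measurable_mono simp: mono_def P0.cdf_nondecreasing)
    note [measurable] = this
    have nonneg: "\<phi> u * cdf P0 (t - u) \<ge> 0" for u by (simp add: \<phi>_nonneg P0.cdf_nonneg)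
    have "(\<integral>x. k x * smoothed \<phi> (t - x) \<partial>lborel)
        = enn2real (\<integral>\<^sup>+x. ennreal (k x * smoothed \<phi> (t - x)) \<partial>lborel)"
      by (rule integral_eq_nn_integral) (auto simp: k_nonneg smoothed_nonneg)
    also have "(\<integral>\<^sup>+x. ennreal (k x * smoothed \<phi> (t - x)) \<partial>lborel)
        = (\<integral>\<^sup>+u. ennreal (\<phi> u) * emeasure P0 {..t - u} \<partial>lborel)"
      unfolding smoothed_tail_identity[symmetric] k_ennreal[symmetric]
      by (simp add: ennreal_mult k_nonneg smoothed_nonneg)
    also have "\<dots> = (\<integral>\<^sup>+u. ennreal (\<phi> u * cdf P0 (t - u)) \<partial>lborel)"
      by (simp add: ennreal_mult \<phi>_nonneg P0.cdf_nonneg cdf_def P0.emeasure_eq_measure)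
    also have "enn2real \<dots> = (\<integral>u. \<phi> u * cdf P0 (t - u) \<partial>lborel)"
      by (rule integral_eq_nn_integral[symmetric]) (auto simp: nonneg)
    finally show ?thesis .
  qed
  have "((\<lambda>t. \<integral>u. \<phi> u * cdf P0 (t - u) \<partial>lborel) \<longlongrightarrow> (\<integral>u. \<phi> u \<partial>lborel)) at_top"
  proof (rule integral_dominated_convergence_at_top[where w = \<phi>])
    show "(\<lambda>u. \<phi> u * cdf P0 (t - u)) \<in> borel_measurable lborel" for t
    proof -
      have "(\<lambda>u. cdf P0 (t - u)) \<in> borel_measurable borel"
        by (rule measurable_compose[where f = "\<lambda>u. t - u" and g = "cdf P0" and N = borel])
          (auto intro!: borel_measurable_mono simp: mono_def P0.cdf_nondecreasing)
      then show ?thesis by simp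
    qed
    show "AE u in lborel. ((\<lambda>t. \<phi> u * cdf P0 (t - u)) \<longlongrightarrow> \<phi> u) at_top"
    proof (rule AE_I2)
      fix u
      show "((\<lambda>t. \<phi> u * cdf P0 (t - u)) \<longlongrightarrow> \<phi> u) at_top"
        using tendsto_mult[OF tendsto_const[of "\<phi> u"]
            filterlim_compose[OF P0.cdf_lim_at_top_prob filterlim_minus_const_at_top[of u]]] by simp
    qed
    show "\<forall>\<^sub>F t in at_top. AE u in lborel. norm (\<phi> u * cdf P0 (t - u)) \<le> \<phi> u"
      using \<phi>_nonneg P0.cdf_nonneg P0.cdf_bounded_prob by (simp add: abs_mult mult_left_le)
  qed (use \<phi>_integrable_lborel in auto)
  then have lim1: "((\<lambda>t. \<integral>x. k x * smoothed \<phi> (t - x) \<partial>lborel) \<longlongrightarrow> (\<integral>u. \<phi> u \<partial>lborel)) at_top"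
    unfolding conv .
  have lim2: "((\<lambda>t. \<integral>x. k x * (smoothed \<phi> t - smoothed \<phi> (t - x)) \<partial>lborel) \<longlongrightarrow> (\<integral>x. 0 \<partial>(lborel :: real measure))) at_top"
  proof (rule integral_dominated_convergence_at_top[where w = "\<lambda>x. 2 * B * k x"])
    show "AE x in lborel. ((\<lambda>t. k x * (smoothed \<phi> t - smoothed \<phi> (t - x))) \<longlongrightarrow> 0) at_top"
    proof (rule AE_I2)
      fix x :: real
      show "((\<lambda>t. k x * (smoothed \<phi> t - smoothed \<phi> (t - x))) \<longlongrightarrow> 0) at_top"
      proof (cases "x \<ge> 0")
        case True
        from tendsto_mult[OF tendsto_const[of "k x"] smoothed_increment_tendsto_0[OF True]]
        show ?thesis by simp
      qed (simp add: k_def)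
    qed
    show "\<forall>\<^sub>F t in at_top. AE x in lborel. norm (k x * (smoothed \<phi> t - smoothed \<phi> (t - x))) \<le> 2 * B * k x"
    proof (intro always_eventually allI AE_I2)
      fix t x
      have "\<bar>smoothed \<phi> t - smoothed \<phi> (t - x)\<bar> \<le> 2 * B" using B[of t] B[of "t - x"] by linarith
      then show "norm (k x * (smoothed \<phi> t - smoothed \<phi> (t - x))) \<le> 2 * B * k x"
        using k_nonneg[of x] by (simp add: abs_mult mult_left_mono mult.commute)
    qed
  qed (use k_integrable in auto)
  have "(\<integral>x. k x * (smoothed \<phi> t - smoothed \<phi> (t - x)) \<partial>lborel) + (\<integral>x. k x * smoothed \<phi> (t - x) \<partial>lborel)
      = \<mu> * smoothed \<phi> t" for t
  proof -
    have "(\<integral>x. k x * (smoothed \<phi> t - smoothed \<phi> (t - x)) \<partial>lborel)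
        = (\<integral>x. k x * smoothed \<phi> t \<partial>lborel) - (\<integral>x. k x * smoothed \<phi> (t - x) \<partial>lborel)"
      using kG_integrable k_integrable
      by (subst Bochner_Integration.integral_diff[symmetric]) (auto simp: algebra_simps)
    then show ?thesis by (simp add: k_integral)
  qed
  with tendsto_add[OF lim2 lim1] have "((\<lambda>t. \<mu> * smoothed \<phi> t) \<longlongrightarrow> (\<integral>u. \<phi> u \<partial>lborel)) at_top" by simp
  from tendsto_divide[OF this tendsto_const[of \<mu>]] \<mu> show ?thesis by (simp add: \<mu>_def[symmetric])
qed

end

end

section \<open>Blackwell's theorem\<close>

text \<open>
  A Lipschitz function that vanishes outside \<open>(a, b)\<close>, equals 1 on \<open>[a + \<delta>, b - \<delta>]\<close> and is affine
  between.
\<close>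

definition trapezoid :: "real \<Rightarrow> real \<Rightarrow> real \<Rightarrow> real \<Rightarrow> real" where
  "trapezoid a b \<delta> x = max 0 (min 1 (min ((x - a) / \<delta>) ((b - x) / \<delta>)))"

lemma trapezoid_bounds: "0 \<le> trapezoid a b \<delta> x" "trapezoid a b \<delta> x \<le> 1"
  by (auto simp: trapezoid_def)

lemma trapezoid_eq_0: "\<delta> > 0 \<Longrightarrow> x \<le> a \<or> x \<ge> b \<Longrightarrow> trapezoid a b \<delta> x = 0"
proof -
  assume "\<delta> > 0" "x \<le> a \<or> x \<ge> b"
  then have "(x - a) / \<delta> \<le> 0 \<or> (b - x) / \<delta> \<le> 0" by (auto simp: divide_nonpos_pos)
  then show ?thesis unfolding trapezoid_def by linarith
qed

lemma trapezoid_eq_1: "\<delta> > 0 \<Longrightarrow> a + \<delta> \<le> x \<Longrightarrow> x \<le> b - \<delta> \<Longrightarrow> trapezoid a b \<delta> x = 1"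
  by (auto simp: trapezoid_def max_def min_def field_simps)

lemma trapezoid_uniformly_continuous:
  assumes "\<delta> > 0"
  shows "uniformly_continuous_on UNIV (trapezoid a b \<delta>)"
  unfolding uniformly_continuous_on_def dist_real_def
proof (intro allI impI)
  fix e :: real assume "e > 0"
  have "\<bar>trapezoid a b \<delta> x - trapezoid a b \<delta> y\<bar> \<le> \<bar>x - y\<bar> / \<delta>" for x y
  proof -
    define u v w where "u = (x - a) / \<delta>" and "v = (b - x) / \<delta>" and "w = (x - y) / \<delta>"
    have "(y - a) / \<delta> = u - w" "(b - y) / \<delta> = v + w"
      by (simp_all add: u_def v_def w_def diff_divide_distrib)
    then have "\<bar>trapezoid a b \<delta> x - trapezoid a b \<delta> y\<bar>
        = \<bar>max 0 (min 1 (min u v)) - max 0 (min 1 (min (u - w) (v + w)))\<bar>"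
      by (simp add: trapezoid_def u_def v_def)
    also have "\<dots> \<le> \<bar>w\<bar>" by (auto simp: max_def min_def abs_le_iff)
    also have "\<dots> = \<bar>x - y\<bar> / \<delta>" unfolding w_def abs_divide using assms by simp
    finally show ?thesis .
  qed
  then have "\<bar>trapezoid a b \<delta> x - trapezoid a b \<delta> y\<bar> < e" if "\<bar>x - y\<bar> < e * \<delta>" for x y
    using that assms by (metis le_less_trans pos_divide_less_eq)
  then show "\<exists>d>0. \<forall>x\<in>UNIV. \<forall>x'\<in>UNIV. \<bar>x' - x\<bar> < d \<longrightarrow> \<bar>trapezoid a b \<delta> x' - trapezoid a b \<delta> x\<bar> < e"
    using \<open>e > 0\<close> assms by (intro exI[of _ "e * \<delta>"]) auto
qed

lemma trapezoid_integral:
  assumes "\<delta> > 0" "a + 2 * \<delta> \<le> b"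
  shows "b - a - 2 * \<delta> \<le> (\<integral>x. trapezoid a b \<delta> x \<partial>lborel)"
    and "(\<integral>x. trapezoid a b \<delta> x \<partial>lborel) \<le> b - a"
proof -
  have [measurable]: "trapezoid a b \<delta> \<in> borel_measurable borel"
    unfolding trapezoid_def by measurable
  have above: "trapezoid a b \<delta> x \<le> indicator {a..b} x" for x
    using trapezoid_bounds(2)[of a b \<delta> x] trapezoid_eq_0[OF assms(1), of x a b]
    by (auto simp: indicator_def)
  have below: "indicator {a + \<delta>..b - \<delta>} x \<le> trapezoid a b \<delta> x" for x
    using trapezoid_bounds(1)[of a b \<delta> x] trapezoid_eq_1[OF assms(1), of a x b]
    by (auto simp: indicator_def)
  have int_ind: "integrable lborel (\<lambda>x. indicator {u..v} x :: real)" for u v :: real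
    by (intro integrable_real_indicator) (auto simp: emeasure_lborel_Icc_eq)
  have int: "integrable lborel (trapezoid a b \<delta>)"
    by (rule Bochner_Integration.integrable_bound[OF int_ind[of a b]])
      (use above trapezoid_bounds in auto)
  show "(\<integral>x. trapezoid a b \<delta> x \<partial>lborel) \<le> b - a"
    using integral_mono[OF int int_ind above] assms by simp
  show "b - a - 2 * \<delta> \<le> (\<integral>x. trapezoid a b \<delta> x \<partial>lborel)"
    using integral_mono[OF int_ind int below] assms by simp
qed

context renewal_equation
begin

text \<open>
  With \<open>x = t - y\<close>, the window \<open>{t - h<..t}\<close> for \<open>y\<close> becomes \<open>{0..<h}\<close> for \<open>x\<close>. Its indicator lies between
  the trapezoids over \<open>(0, h)\<close> and over \<open>(- \<delta>, h + \<delta>)\<close>, whose integrals differ from \<open>h\<close> by at most \<open>2 \<delta>\<close>.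
\<close>

lemma blackwell:
  assumes h: "h > 0"
  shows "((\<lambda>t. measure W {t - h<..t}) \<longlongrightarrow> h / (\<integral>x. x \<partial>F)) at_top"
proof -
  define \<mu> where "\<mu> = (\<integral>x. x \<partial>F)"
  have \<mu>: "\<mu> > 0" using F_mean_pos by (simp add: \<mu>_def)
  have tends: "(smoothed (trapezoid a b \<delta>) \<longlongrightarrow> (\<integral>u. trapezoid a b \<delta> u \<partial>lborel) / \<mu>) at_top"
    if "\<delta> > 0" for a b \<delta>
    unfolding \<mu>_def
    by (rule smoothed_tendsto[of _ "\<bar>a\<bar> + \<bar>b\<bar> + 1"])
      (use that in \<open>auto intro!: trapezoid_uniformly_continuous trapezoid_bounds trapezoid_eq_0\<close>)
  have int: "integrable W (\<lambda>y. trapezoid a b \<delta> (t - y))" if "\<delta> > 0" for a b \<delta> t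
    by (rule \<phi>_integrable_W[of _ "\<bar>a\<bar> + \<bar>b\<bar> + 1"])
      (use that in \<open>auto intro!: trapezoid_uniformly_continuous trapezoid_bounds trapezoid_eq_0\<close>)
  have ind: "integrable W (\<lambda>y. indicator {t - h<..t} y :: real)" for t
    using W_interval_finite by (simp add: sets_W)
  show ?thesis unfolding \<mu>_def[symmetric]
  proof (rule order_tendstoI)
    fix e assume e: "e < h / \<mu>"
    define \<delta> where "\<delta> = min (h / 2) ((h - e * \<mu>) / 4)"
    have "e * \<mu> < h" using e \<mu> by (simp add: field_simps)
    then have \<delta>: "\<delta> > 0" "2 * \<delta> \<le> h" "4 * \<delta> \<le> h - e * \<mu>"
      using h unfolding \<delta>_def by (simp_all add: min_def field_simps)
    have "e * \<mu> < h - 2 * \<delta>" using \<delta> by linarith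
    also have "\<dots> \<le> (\<integral>u. trapezoid 0 h \<delta> u \<partial>lborel)" using trapezoid_integral(1)[of \<delta> 0 h] \<delta> by simp
    finally have "e < (\<integral>u. trapezoid 0 h \<delta> u \<partial>lborel) / \<mu>" using \<mu> by (simp add: field_simps)
    with tends[OF \<delta>(1)] have "eventually (\<lambda>t. e < smoothed (trapezoid 0 h \<delta>) t) at_top"
      by (rule order_tendstoD)
    moreover have "smoothed (trapezoid 0 h \<delta>) t \<le> measure W {t - h<..t}" for t
    proof -
      have "smoothed (trapezoid 0 h \<delta>) t \<le> (\<integral>y. indicator {t - h<..t} y \<partial>W)"
        unfolding smoothed_def
      proof (rule integral_mono[OF int[OF \<delta>(1)] ind])
        fix y
        show "trapezoid 0 h \<delta> (t - y) \<le> indicator {t - h<..t} y"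
          using trapezoid_eq_0[OF \<delta>(1), of "t - y" 0 h] trapezoid_bounds(2)[of 0 h \<delta> "t - y"]
          by (auto simp: indicator_def)
      qed
      then show ?thesis by simp
    qed
    ultimately show "eventually (\<lambda>t. e < measure W {t - h<..t}) at_top"
      by (auto elim!: eventually_mono intro: less_le_trans)
  next
    fix e assume e: "h / \<mu> < e"
    define \<delta> where "\<delta> = (e * \<mu> - h) / 4"
    have "h < e * \<mu>" using e \<mu> by (simp add: field_simps)
    then have \<delta>: "\<delta> > 0" "4 * \<delta> = e * \<mu> - h" by (auto simp: \<delta>_def)
    have "(\<integral>u. trapezoid (- \<delta>) (h + \<delta>) \<delta> u \<partial>lborel) \<le> h + 2 * \<delta>"
      using trapezoid_integral(2)[of \<delta> "- \<delta>" "h + \<delta>"] \<delta> h by simp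
    also have "\<dots> < e * \<mu>" using \<delta> by linarith
    finally have "(\<integral>u. trapezoid (- \<delta>) (h + \<delta>) \<delta> u \<partial>lborel) / \<mu> < e" using \<mu> by (simp add: field_simps)
    with tends[OF \<delta>(1)] have "eventually (\<lambda>t. smoothed (trapezoid (- \<delta>) (h + \<delta>) \<delta>) t < e) at_top"
      by (rule order_tendstoD)
    moreover have "measure W {t - h<..t} \<le> smoothed (trapezoid (- \<delta>) (h + \<delta>) \<delta>) t" for t
    proof -
      have "(\<integral>y. indicator {t - h<..t} y \<partial>W) \<le> smoothed (trapezoid (- \<delta>) (h + \<delta>) \<delta>) t"
        unfolding smoothed_def
      proof (rule integral_mono[OF ind int[OF \<delta>(1)]])
        fix y
        show "indicator {t - h<..t} y \<le> trapezoid (- \<delta>) (h + \<delta>) \<delta> (t - y)"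
          using trapezoid_eq_1[OF \<delta>(1), of "- \<delta>" "t - y" "h + \<delta>"] trapezoid_bounds(1)[of "- \<delta>" "h + \<delta>" \<delta> "t - y"]
          by (auto simp: indicator_def)
      qed
      then show ?thesis by simp
    qed
    ultimately show "eventually (\<lambda>t. measure W {t - h<..t} < e) at_top"
      by (auto elim!: eventually_mono intro: le_less_trans)
  qed
qed

end

section \<open>The epochs of a renewal cluster process\<close>

lemma borel_measurable_sum_upto_random:
  fixes f :: "nat \<Rightarrow> 'b \<Rightarrow> 'c :: {second_countable_topology, topological_comm_monoid_add}"
  assumes [measurable]: "l \<in> measurable N (count_space UNIV)"
    and f: "\<And>j. j \<ge> 1 \<Longrightarrow> f j \<in> borel_measurable N"
  shows "(\<lambda>p. \<Sum>j=1..l p. f j p) \<in> borel_measurable N"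
  by (rule measurable_compose_countable[of "\<lambda>n p. \<Sum>j=1..n. f j p" N borel l])
    (auto intro!: borel_measurable_sum f)

lemma summed_geometric_bound:
  fixes a :: "nat \<Rightarrow> ennreal"
  assumes "a 0 \<le> 1" "\<And>i. a (Suc i) \<le> a i * ennreal r" "0 \<le> r" "r < 1"
  shows "(\<Sum>i. a i) < \<infinity>"
proof -
  have "a i \<le> ennreal (r ^ i)" for i
  proof (induction i)
    case (Suc i)
    have "a (Suc i) \<le> ennreal (r ^ i) * ennreal r"
      using assms(2)[of i] mult_right_mono[OF Suc, of "ennreal r"] by (rule order_trans) simp
    also have "\<dots> = ennreal (r ^ Suc i)" using assms by (simp add: ennreal_mult[symmetric] mult.commute)
    finally show ?case .
  qed (use assms in simp)
  then have "(\<Sum>i. a i) \<le> (\<Sum>i. ennreal (r ^ i))" by (intro suminf_le) auto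
  also have "\<dots> = ennreal (1 / (1 - r))"
    using geometric_sums[of r] assms by (intro suminf_ennreal_eq) auto
  finally show ?thesis by (rule le_less_trans) simp
qed

context renewal_cluster_process
begin

lemma mark_measurable [measurable]: "mark X L T i \<in> measurable M mark_space"
  using indep_marks unfolding indep_vars_def by auto

lemma mark_space_projections [measurable]:
  "fst \<in> measurable mark_space (count_space UNIV)"
  "(\<lambda>p. snd (snd p)) \<in> borel_measurable mark_space"
  unfolding mark_space_def by measurable

lemma mark_space_points:
  assumes "j \<ge> 1"
  shows "(\<lambda>p. fst (snd p) j) \<in> borel_measurable mark_space"
proof -
  have "(\<lambda>\<tau>. \<tau> j) \<in> borel_measurable (\<Pi>\<^sub>M j\<in>{1..}. borel :: real measure)"
    by (rule measurable_component_singleton) (use assms in simp)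
  from measurable_compose[OF measurable_compose[OF measurable_snd measurable_fst] this]
  show ?thesis unfolding mark_space_def .
qed

lemma X_measurable [measurable]: "X i \<in> borel_measurable M"
  using measurable_compose[OF mark_measurable[of i] mark_space_projections(2)] by (simp add: mark_def)

lemma L_measurable [measurable]: "L i \<in> measurable M (count_space UNIV)"
  using measurable_compose[OF mark_measurable[of i] mark_space_projections(1)] by (simp add: mark_def)

lemma T_measurable: "j \<ge> 1 \<Longrightarrow> T i j \<in> borel_measurable M"
  using measurable_compose[OF mark_measurable[of i] mark_space_points[of j]] by (simp add: mark_def)

abbreviation epoch :: "nat \<Rightarrow> 'a \<Rightarrow> real" where "epoch \<equiv> renewal_epoch X"

lemma epoch_measurable [measurable]: "epoch i \<in> borel_measurable M"
  unfolding renewal_epoch_def by measurable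

lemma epoch_0: "epoch 0 \<omega> = X 0 \<omega>"
  by (simp add: renewal_epoch_def)

lemma epoch_Suc: "epoch (Suc i) \<omega> = epoch i \<omega> + X (Suc i) \<omega>"
  by (simp add: renewal_epoch_def)

text \<open>
  The epoch with index \<open>i\<close> is a function of the marks up to \<open>i\<close>, hence independent of mark \<open>i + 1\<close>, which in
  turn is distributed like mark 1. So the latter may be sampled afresh.
\<close>

lemma nn_integral_epoch_mark:
  assumes [measurable]: "h \<in> borel_measurable (borel \<Otimes>\<^sub>M mark_space)"
  shows "(\<integral>\<^sup>+\<omega>. h (epoch i \<omega>, mark X L T (Suc i) \<omega>) \<partial>M)
    = (\<integral>\<^sup>+\<omega>. (\<integral>\<^sup>+\<omega>'. h (epoch i \<omega>, mark X L T 1 \<omega>') \<partial>M) \<partial>M)"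
proof -
  let ?past = "\<lambda>\<omega>. \<lambda>j\<in>{..i}. mark X L T j \<omega>"
  let ?next = "\<lambda>\<omega>. \<lambda>j\<in>{Suc i}. mark X L T j \<omega>"
  let ?Past = "\<Pi>\<^sub>M j\<in>{..i}. mark_space"
  let ?Next = "\<Pi>\<^sub>M j\<in>{Suc i}. mark_space"
  have "indep_var ?Past ?past ?Next ?next"
    by (rule indep_var_restrict[OF indep_marks]) auto
  then have law: "distr M (?Past \<Otimes>\<^sub>M ?Next) (\<lambda>\<omega>. (?past \<omega>, ?next \<omega>))
      = distr M ?Past ?past \<Otimes>\<^sub>M distr M ?Next ?next"
    by (simp add: indep_var_distribution_eq)
  have same_law: "distr M mark_space (mark X L T (Suc i)) = distr M mark_space (mark X L T 1)"
    by (rule identically_distributed) simp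
  have past [measurable]: "?past \<in> measurable M ?Past" by measurable
  have next_meas [measurable]: "?next \<in> measurable M ?Next" by measurable
  have sum_meas: "(\<lambda>m. \<Sum>j=0..i. snd (snd (m j))) \<in> borel_measurable ?Past"
    by (intro borel_measurable_sum measurable_compose[OF _ mark_space_projections(2)]
        measurable_component_singleton) auto
  have last_meas: "(\<lambda>m. m (Suc i)) \<in> measurable ?Next mark_space"
    by (rule measurable_component_singleton) simp
  have g_meas: "(\<lambda>p. h (\<Sum>j=0..i. snd (snd (fst p j)), snd p (Suc i))) \<in> borel_measurable (?Past \<Otimes>\<^sub>M ?Next)"
    by (intro measurable_compose[OF _ assms] measurable_Pair measurable_compose[OF measurable_fst sum_meas]
        measurable_compose[OF measurable_snd last_meas])
  have past_eq: "(\<Sum>j=0..i. snd (snd (?past \<omega> j))) = epoch i \<omega>" for \<omega>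
    by (simp add: renewal_epoch_def mark_def)
  interpret N: prob_space "distr M ?Next ?next" by (rule prob_space_distr) measurable
  have inner_meas: "(\<lambda>m. h (s, m)) \<in> borel_measurable mark_space" for s by measurable
  have "(\<integral>\<^sup>+\<omega>. h (epoch i \<omega>, mark X L T (Suc i) \<omega>) \<partial>M)
    = (\<integral>\<^sup>+p. h (\<Sum>j=0..i. snd (snd (fst p j)), snd p (Suc i))
        \<partial>distr M (?Past \<Otimes>\<^sub>M ?Next) (\<lambda>\<omega>. (?past \<omega>, ?next \<omega>)))"
    by (subst nn_integral_distr) (use g_meas past_eq in auto)
  also have "\<dots> = (\<integral>\<^sup>+u. (\<integral>\<^sup>+m. h (\<Sum>j=0..i. snd (snd (u j)), m (Suc i)) \<partial>distr M ?Next ?next) \<partial>distr M ?Past ?past)"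
    unfolding law
    using N.nn_integral_fst[of "\<lambda>p. h (\<Sum>j=0..i. snd (snd (fst p j)), snd p (Suc i))" "distr M ?Past ?past"] g_meas
    by (simp add: measurable_cong_sets[OF sets_pair_measure_cong[OF sets_distr sets_distr] refl])
  also have "\<dots> = (\<integral>\<^sup>+\<omega>. (\<integral>\<^sup>+m. h (epoch i \<omega>, m (Suc i)) \<partial>distr M ?Next ?next) \<partial>M)"
  proof -
    have "(\<lambda>p. h (\<Sum>j=0..i. snd (snd (fst p j)), snd p (Suc i))) \<in> borel_measurable (?Past \<Otimes>\<^sub>M distr M ?Next ?next)"
      using g_meas by (simp add: measurable_cong_sets[OF sets_pair_measure_cong[OF refl sets_distr] refl])
    from N.borel_measurable_nn_integral_fst[OF this]
    have "(\<lambda>u. \<integral>\<^sup>+m. h (\<Sum>j=0..i. snd (snd (u j)), m (Suc i)) \<partial>distr M ?Next ?next) \<in> borel_measurable ?Past"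
      by simp
    then show ?thesis using past_eq by (simp only: nn_integral_distr[OF past] measurable_distr_eq1)
  qed
  also have "\<dots> = (\<integral>\<^sup>+\<omega>. (\<integral>\<^sup>+\<omega>'. h (epoch i \<omega>, mark X L T (Suc i) \<omega>') \<partial>M) \<partial>M)"
    by (intro nn_integral_cong, subst nn_integral_distr[OF next_meas])
      (auto intro: measurable_compose[OF last_meas inner_meas])
  also have "\<dots> = (\<integral>\<^sup>+\<omega>. (\<integral>\<^sup>+m. h (epoch i \<omega>, m) \<partial>distr M mark_space (mark X L T (Suc i))) \<partial>M)"
    by (intro nn_integral_cong nn_integral_distr[symmetric] mark_measurable) (simp add: inner_meas)
  also have "\<dots> = (\<integral>\<^sup>+\<omega>. (\<integral>\<^sup>+\<omega>'. h (epoch i \<omega>, mark X L T 1 \<omega>') \<partial>M) \<partial>M)"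
    unfolding same_law
    by (intro nn_integral_cong nn_integral_distr mark_measurable) (simp add: inner_meas)
  finally show ?thesis .
qed

text \<open>
  The sum over \<open>i\<close> of the laws of the epochs, written as a single image measure so that Fubini's theorem
  becomes available.
\<close>

definition epoch_measure :: "real measure" where
  "epoch_measure = distr (count_space UNIV \<Otimes>\<^sub>M M) borel (\<lambda>p. epoch (fst p) (snd p))"

lemma epoch_pair_measurable [measurable]:
  "(\<lambda>p. epoch (fst p) (snd p)) \<in> borel_measurable (count_space UNIV \<Otimes>\<^sub>M M)"
  by (rule measurable_compose_countable[of "\<lambda>n p. epoch n (snd p)" _ _ fst]) simp_all

lemma sets_epoch_measure [measurable_cong]: "sets epoch_measure = sets borel"
  by (simp add: epoch_measure_def)

lemma nn_integral_epoch_measure: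
  assumes [measurable]: "f \<in> borel_measurable borel"
  shows "(\<integral>\<^sup>+x. f x \<partial>epoch_measure) = (\<Sum>i. \<integral>\<^sup>+\<omega>. f (epoch i \<omega>) \<partial>M)"
proof -
  have "(\<integral>\<^sup>+x. f x \<partial>epoch_measure) = (\<integral>\<^sup>+p. f (epoch (fst p) (snd p)) \<partial>(count_space UNIV \<Otimes>\<^sub>M M))"
    unfolding epoch_measure_def by (rule nn_integral_distr) measurable
  also have "\<dots> = (\<integral>\<^sup>+i. (\<integral>\<^sup>+\<omega>. f (epoch i \<omega>) \<partial>M) \<partial>count_space UNIV)"
    using nn_integral_fst[of "\<lambda>p. f (epoch (fst p) (snd p))" "count_space UNIV"] by simp
  finally show ?thesis by (simp add: nn_integral_count_space_nat)
qed

text \<open>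
  Equality would force \<open>X 1 = 0\<close> almost surely, against the positive mean.
\<close>

lemma laplace_lt_1: "(\<integral>\<omega>. exp (- X 1 \<omega>) \<partial>M) < 1"
proof -
  have int: "integrable M (\<lambda>\<omega>. exp (- X 1 \<omega>))"
    by (rule integrable_const_bound[of _ 1]) (use increment_nonneg in auto)
  have nonneg: "AE \<omega> in M. 0 \<le> 1 - exp (- X 1 \<omega>)" using increment_nonneg by auto
  have "(\<integral>\<omega>. 1 - exp (- X 1 \<omega>) \<partial>M) \<noteq> 0"
  proof
    assume "(\<integral>\<omega>. 1 - exp (- X 1 \<omega>) \<partial>M) = 0"
    then have "AE \<omega> in M. 1 - exp (- X 1 \<omega>) = 0"
      using integral_nonneg_eq_0_iff_AE[OF Bochner_Integration.integrable_diff[OF integrable_const int] nonneg] by simp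
    then have "AE \<omega> in M. X 1 \<omega> = 0" by eventually_elim simp
    then have "expectation (X 1) = expectation (\<lambda>_. 0)" by (intro integral_cong_AE) auto
    with increment_mean_pos show False by simp
  qed
  moreover have "(\<integral>\<omega>. 1 - exp (- X 1 \<omega>) \<partial>M) \<ge> 0" by (rule integral_nonneg_AE[OF nonneg])
  ultimately show ?thesis using int by (simp add: prob_space)
qed

text \<open>
  By independence, the Laplace transforms of the epochs at 1 decay geometrically, with ratio
  \<open>E[exp (- X 1)] < 1\<close>; Markov's inequality turns this into summability of the probabilities that
  the epochs stay below \<open>t\<close>.
\<close>

lemma epoch_measure_finite: "emeasure epoch_measure {..t} < \<infinity>"
proof -
  define a where "a i = (\<integral>\<^sup>+\<omega>. ennreal (exp (- epoch i \<omega>)) \<partial>M)" for i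
  define r where "r = (\<integral>\<omega>. exp (- X 1 \<omega>) \<partial>M)"
  have r: "(\<integral>\<^sup>+\<omega>. ennreal (exp (- X 1 \<omega>)) \<partial>M) = ennreal r"
    unfolding r_def
    by (intro nn_integral_eq_integral integrable_const_bound[of _ 1]) (use increment_nonneg in auto)
  have a0: "a 0 \<le> 1"
  proof -
    have "a 0 \<le> (\<integral>\<^sup>+\<omega>. 1 \<partial>M)"
      unfolding a_def using increment_nonneg[of _ 0] by (intro nn_integral_mono) (auto simp: epoch_0)
    then show ?thesis by (simp add: emeasure_space_1)
  qed
  have aS: "a (Suc i) = a i * ennreal r" for i
  proof -
    have "a (Suc i) = (\<integral>\<^sup>+\<omega>. (\<lambda>p. ennreal (exp (- fst p)) * ennreal (exp (- snd (snd (snd p))))) (epoch i \<omega>, mark X L T (Suc i) \<omega>) \<partial>M)"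
      unfolding a_def by (simp add: epoch_Suc mark_def ennreal_mult[symmetric] exp_add[symmetric])
    also have "\<dots> = (\<integral>\<^sup>+\<omega>. (\<integral>\<^sup>+\<omega>'. ennreal (exp (- epoch i \<omega>)) * ennreal (exp (- X 1 \<omega>')) \<partial>M) \<partial>M)"
      by (subst nn_integral_epoch_mark) (auto simp: mark_def)
    also have "\<dots> = a i * ennreal r"
      unfolding a_def by (simp add: nn_integral_cmult nn_integral_multc r[symmetric])
    finally show ?thesis .
  qed
  have "emeasure epoch_measure {..t} = (\<Sum>i. \<integral>\<^sup>+\<omega>. indicator {..t} (epoch i \<omega>) \<partial>M)"
    by (subst nn_integral_epoch_measure[symmetric]) (auto simp: sets_epoch_measure)
  also have "\<dots> \<le> (\<Sum>i. ennreal (exp t) * a i)"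
  proof (intro suminf_le allI)
    fix i
    have "(\<integral>\<^sup>+\<omega>. indicator {..t} (epoch i \<omega>) \<partial>M) \<le> (\<integral>\<^sup>+\<omega>. ennreal (exp t) * ennreal (exp (- epoch i \<omega>)) \<partial>M)"
    proof (rule nn_integral_mono)
      fix \<omega>
      show "indicator {..t} (epoch i \<omega>) \<le> ennreal (exp t) * ennreal (exp (- epoch i \<omega>))"
        by (auto simp: indicator_def ennreal_mult[symmetric] exp_add[symmetric])
    qed
    then show "(\<integral>\<^sup>+\<omega>. indicator {..t} (epoch i \<omega>) \<partial>M) \<le> ennreal (exp t) * a i"
      unfolding a_def by (simp add: nn_integral_cmult)
  qed auto
  also have "\<dots> = ennreal (exp t) * (\<Sum>i. a i)" by (rule ennreal_suminf_cmult)
  also have "\<dots> < \<infinity>"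
    using summed_geometric_bound[of a r] a0 aS laplace_lt_1
    by (auto simp: ennreal_mult_less_top r_def)
  finally show ?thesis .
qed

text \<open>
  The renewal equation splits off the epoch of index 0; every later epoch is its predecessor plus an
  independent increment.
\<close>

sublocale renewal: renewal_equation "distr M borel (X 1)" "distr M borel (X 0)" epoch_measure
proof (intro renewal_equation.intro renewal_equation_axioms.intro)
  show "real_distribution (distr M borel (X 1))" "real_distribution (distr M borel (X 0))"
    by (auto intro: real_distribution_distr)
  show "AE x in distr M borel (X 1). 0 \<le> x"
    using increment_nonneg by (subst AE_distr_iff) auto
  show "integrable (distr M borel (X 1)) (\<lambda>x. x)"
    using increment_finite_mean by (simp add: integrable_distr_eq)
  show "0 < (\<integral>x. x \<partial>distr M borel (X 1))"
    using increment_mean_pos by (simp add: integral_distr)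
  fix f :: "real \<Rightarrow> ennreal" assume f [measurable]: "f \<in> borel_measurable borel"
  have step: "(\<integral>\<^sup>+\<omega>. f (epoch (Suc i) \<omega>) \<partial>M)
      = (\<integral>\<^sup>+\<omega>. (\<integral>\<^sup>+y. f (epoch i \<omega> + y) \<partial>distr M borel (X 1)) \<partial>M)" for i
  proof -
    have "(\<integral>\<^sup>+\<omega>. f (epoch (Suc i) \<omega>) \<partial>M)
        = (\<integral>\<^sup>+\<omega>. (\<lambda>p. f (fst p + snd (snd (snd p)))) (epoch i \<omega>, mark X L T (Suc i) \<omega>) \<partial>M)"
      by (simp add: epoch_Suc mark_def)
    also have "\<dots> = (\<integral>\<^sup>+\<omega>. (\<integral>\<^sup>+\<omega>'. f (epoch i \<omega> + X 1 \<omega>') \<partial>M) \<partial>M)"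
      by (subst nn_integral_epoch_mark) (auto simp: mark_def)
    also have "\<dots> = (\<integral>\<^sup>+\<omega>. (\<integral>\<^sup>+y. f (epoch i \<omega> + y) \<partial>distr M borel (X 1)) \<partial>M)"
      by (simp add: nn_integral_distr)
    finally show ?thesis .
  qed
  have "(\<integral>\<^sup>+x. f x \<partial>epoch_measure) = (\<integral>\<^sup>+\<omega>. f (epoch 0 \<omega>) \<partial>M) + (\<Sum>i. \<integral>\<^sup>+\<omega>. f (epoch (Suc i) \<omega>) \<partial>M)"
    unfolding nn_integral_epoch_measure[OF f]
    using suminf_offset[of "\<lambda>i. \<integral>\<^sup>+\<omega>. f (epoch i \<omega>) \<partial>M" 1] by simp
  also have "(\<lambda>i. \<integral>\<^sup>+\<omega>. f (epoch (Suc i) \<omega>) \<partial>M)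
      = (\<lambda>i. \<integral>\<^sup>+\<omega>. (\<integral>\<^sup>+y. f (epoch i \<omega> + y) \<partial>distr M borel (X 1)) \<partial>M)"
    by (rule ext) (rule step)
  also have "(\<integral>\<^sup>+\<omega>. f (epoch 0 \<omega>) \<partial>M) = (\<integral>\<^sup>+x. f x \<partial>distr M borel (X 0))"
    by (simp add: nn_integral_distr epoch_0)
  also have "(\<Sum>i. \<integral>\<^sup>+\<omega>. (\<integral>\<^sup>+y. f (epoch i \<omega> + y) \<partial>distr M borel (X 1)) \<partial>M)
      = (\<integral>\<^sup>+x. (\<integral>\<^sup>+y. f (x + y) \<partial>distr M borel (X 1)) \<partial>epoch_measure)"
  proof -
    interpret D: prob_space "distr M borel (X 1)" by (rule prob_space_distr) simp
    have "(\<lambda>x. \<integral>\<^sup>+y. f (x + y) \<partial>distr M borel (X 1)) \<in> borel_measurable borel" by measurable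
    then show ?thesis by (rule nn_integral_epoch_measure[symmetric])
  qed
  finally show "(\<integral>\<^sup>+x. f x \<partial>epoch_measure) = (\<integral>\<^sup>+x. f x \<partial>distr M borel (X 0)) +
      (\<integral>\<^sup>+x. (\<integral>\<^sup>+y. f (x + y) \<partial>distr M borel (X 1)) \<partial>epoch_measure)" .
qed (use sets_epoch_measure increment_nonarithmetic epoch_measure_finite in auto)

lemma integral_increment_distr: "(\<integral>x. x \<partial>distr M borel (X 1)) = expectation (X 1)"
  by (simp add: integral_distr)

end

section \<open>The intensity measure of the cluster process\<close>

context renewal_cluster_process
begin

lemma indicator_point_measurable:
  assumes "B \<in> sets borel" "j \<ge> 1"
  shows "(\<lambda>\<omega>. indicator B (epoch i \<omega> + T i j \<omega>) :: ennreal) \<in> borel_measurable M"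
proof -
  note [measurable] = T_measurable[OF assms(2)] assms(1)
  show ?thesis by measurable
qed

lemma cluster_process_measurable:
  assumes "B \<in> sets borel"
  shows "(\<lambda>\<omega>. cluster_process X L T \<omega> B) \<in> borel_measurable M"
proof -
  have [measurable]: "(\<lambda>\<omega>. \<Sum>j=1..L i \<omega>. indicator B (epoch i \<omega> + T i j \<omega>) :: ennreal) \<in> borel_measurable M" for i
    by (intro borel_measurable_sum_upto_random L_measurable indicator_point_measurable assms)
  show ?thesis unfolding cluster_process_def by measurable
qed

lemma cluster_process_countably_additive:
  assumes "disjoint_family A"
  shows "(\<Sum>n. cluster_process X L T \<omega> (A n)) = cluster_process X L T \<omega> (\<Union>n. A n)"
proof -
  let ?x = "\<lambda>i j. epoch i \<omega> + T i j \<omega>"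
  have "(\<Sum>n. cluster_process X L T \<omega> (A n)) = (\<Sum>i. \<Sum>n. \<Sum>j=1..L i \<omega>. indicator (A n) (?x i j))"
    unfolding cluster_process_def
    using pair_sigma_finite.Fubini'[of "count_space UNIV" "count_space UNIV"
        "\<lambda>n i. \<Sum>j=1..L i \<omega>. indicator (A n) (?x i j) :: ennreal"]
    by (simp add: nn_integral_count_space_nat pair_sigma_finite_def
        sigma_finite_measure_count_space pair_measure_countable)
  also have "\<dots> = (\<Sum>i. \<Sum>j=1..L i \<omega>. \<Sum>n. indicator (A n) (?x i j))"
    by (intro suminf_cong suminf_sum) auto
  also have "\<dots> = cluster_process X L T \<omega> (\<Union>n. A n)"
    unfolding cluster_process_def by (simp add: suminf_indicator[OF assms])
  finally show ?thesis .
qed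

text \<open>
  The measure with distribution function \<open>renewal_fun\<close>; it will turn out to be \<open>renewal_measure\<close>.
\<close>

definition intensity_measure :: "real measure" where
  "intensity_measure = measure_of UNIV (sets borel) (\<lambda>B. \<integral>\<^sup>+\<omega>. cluster_process X L T \<omega> B \<partial>M)"

lemma sets_intensity_measure [measurable_cong]: "sets intensity_measure = sets borel"
  unfolding intensity_measure_def using sets.sigma_sets_eq[of "borel :: real measure"] by simp

lemma emeasure_intensity_measure:
  assumes "B \<in> sets borel"
  shows "emeasure intensity_measure B = (\<integral>\<^sup>+\<omega>. cluster_process X L T \<omega> B \<partial>M)"
proof (rule emeasure_measure_of[OF intensity_measure_def])
  show "positive (sets intensity_measure) (\<lambda>B. \<integral>\<^sup>+\<omega>. cluster_process X L T \<omega> B \<partial>M)"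
    by (auto simp: positive_def cluster_process_def)
  show "countably_additive (sets intensity_measure) (\<lambda>B. \<integral>\<^sup>+\<omega>. cluster_process X L T \<omega> B \<partial>M)"
    unfolding countably_additive_def sets_intensity_measure
  proof (intro allI impI)
    fix A :: "nat \<Rightarrow> real set"
    assume "range A \<subseteq> sets borel" "disjoint_family A"
    then show "(\<Sum>i. \<integral>\<^sup>+\<omega>. cluster_process X L T \<omega> (A i) \<partial>M) = (\<integral>\<^sup>+\<omega>. cluster_process X L T \<omega> (\<Union>(range A)) \<partial>M)"
      by (subst nn_integral_suminf[symmetric])
        (auto intro!: cluster_process_measurable simp: cluster_process_countably_additive)
  qed
qed (use assms in \<open>auto simp: sets_intensity_measure\<close>)

text \<open>
  For \<open>i \<ge> 1\<close> a point of cluster \<open>i\<close> sits at the previous epoch plus \<open>X i + T i j\<close>, a displacement that is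
  a function of mark \<open>i\<close> and hence independent of that epoch. Summation over \<open>i\<close> therefore places an
  independent copy of cluster 1, displaced by \<open>X 1\<close>, at every point of the renewal measure of the epochs.
  The initial cluster has a law of its own and is kept apart.
\<close>

lemma emeasure_intensity_decomposition:
  assumes B [measurable]: "B \<in> sets borel"
  shows "emeasure intensity_measure B
    = (\<integral>\<^sup>+\<omega>. (\<Sum>j=1..L 0 \<omega>. indicator B (X 0 \<omega> + T 0 j \<omega>)) \<partial>M)
    + (\<integral>\<^sup>+\<omega>. (\<Sum>j=1..L 1 \<omega>. emeasure epoch_measure {x. x + (X 1 \<omega> + T 1 j \<omega>) \<in> B}) \<partial>M)"
proof -
  interpret WM: pair_sigma_finite epoch_measure M
    using renewal.sigma_finite_W sigma_finite_measure_axioms by (rule pair_sigma_finite.intro)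
  define h :: "real \<times> nat \<times> (nat \<Rightarrow> real) \<times> real \<Rightarrow> ennreal"
    where "h p = (\<Sum>j=1..fst (snd p). indicator B (fst p + (snd (snd (snd p)) + fst (snd (snd p)) j)))" for p
  have h_meas [measurable]: "h \<in> borel_measurable (borel \<Otimes>\<^sub>M mark_space)"
    unfolding h_def
  proof (rule borel_measurable_sum_upto_random)
    fix j :: nat assume "j \<ge> 1"
    note [measurable] = mark_space_points[OF this]
    show "(\<lambda>p. indicator B (fst p + (snd (snd (snd p)) + fst (snd (snd p)) j)) :: ennreal)
        \<in> borel_measurable (borel \<Otimes>\<^sub>M mark_space)"
      by measurable
  qed measurable
  have h_eq: "h (s, mark X L T i \<omega>) = (\<Sum>j=1..L i \<omega>. indicator B (s + (X i \<omega> + T i j \<omega>)))" for s i \<omega>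
    unfolding h_def mark_def by (auto intro!: sum.cong)
  define c where "c i = (\<integral>\<^sup>+\<omega>. (\<Sum>j=1..L i \<omega>. indicator B (epoch i \<omega> + T i j \<omega>)) \<partial>M)" for i
  have c_Suc: "c (Suc i) = (\<integral>\<^sup>+\<omega>. (\<integral>\<^sup>+\<omega>'. h (epoch i \<omega>, mark X L T 1 \<omega>') \<partial>M) \<partial>M)" for i
  proof -
    have "c (Suc i) = (\<integral>\<^sup>+\<omega>. h (epoch i \<omega>, mark X L T (Suc i) \<omega>) \<partial>M)"
      unfolding c_def h_eq by (simp add: epoch_Suc add.assoc)
    then show ?thesis by (simp only: nn_integral_epoch_mark[OF h_meas])
  qed
  have "emeasure intensity_measure B = (\<Sum>i. c i)"
    unfolding emeasure_intensity_measure[OF B] cluster_process_def c_def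
    by (intro nn_integral_suminf borel_measurable_sum_upto_random L_measurable
        indicator_point_measurable B)
  also have "\<dots> = c 0 + (\<Sum>i. c (Suc i))"
    using suminf_offset[of c 1] by simp
  also have "(\<Sum>i. c (Suc i)) = (\<integral>\<^sup>+s. (\<integral>\<^sup>+\<omega>'. h (s, mark X L T 1 \<omega>') \<partial>M) \<partial>epoch_measure)"
    unfolding c_Suc by (rule nn_integral_epoch_measure[symmetric]) measurable
  also have "\<dots> = (\<integral>\<^sup>+\<omega>'. (\<integral>\<^sup>+s. h (s, mark X L T 1 \<omega>') \<partial>epoch_measure) \<partial>M)"
    by (rule WM.Fubini'[symmetric]) measurable
  also have "\<dots> = (\<integral>\<^sup>+\<omega>. (\<Sum>j=1..L 1 \<omega>. emeasure epoch_measure {x. x + (X 1 \<omega> + T 1 j \<omega>) \<in> B}) \<partial>M)"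
  proof (rule nn_integral_cong)
    fix \<omega>
    have "(\<integral>\<^sup>+s. h (s, mark X L T 1 \<omega>) \<partial>epoch_measure)
        = (\<Sum>j=1..L 1 \<omega>. \<integral>\<^sup>+s. indicator B (s + (X 1 \<omega> + T 1 j \<omega>)) \<partial>epoch_measure)"
      unfolding h_eq by (rule nn_integral_sum) measurable
    also have "\<dots> = (\<Sum>j=1..L 1 \<omega>. emeasure epoch_measure {x. x + (X 1 \<omega> + T 1 j \<omega>) \<in> B})"
    proof (rule sum.cong[OF refl])
      fix j
      have "{x. x + (X 1 \<omega> + T 1 j \<omega>) \<in> B} = (\<lambda>x. x + (X 1 \<omega> + T 1 j \<omega>)) -` B \<inter> space borel" by auto
      also have "\<dots> \<in> sets borel" by (rule measurable_sets[OF _ B]) measurable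
      finally have "{x. x + (X 1 \<omega> + T 1 j \<omega>) \<in> B} \<in> sets epoch_measure"
        by (simp add: sets_epoch_measure)
      then have "(\<integral>\<^sup>+s. indicator {x. x + (X 1 \<omega> + T 1 j \<omega>) \<in> B} s \<partial>epoch_measure)
          = emeasure epoch_measure {x. x + (X 1 \<omega> + T 1 j \<omega>) \<in> B}"
        by (rule nn_integral_indicator)
      then show "(\<integral>\<^sup>+s. indicator B (s + (X 1 \<omega> + T 1 j \<omega>)) \<partial>epoch_measure)
          = emeasure epoch_measure {x. x + (X 1 \<omega> + T 1 j \<omega>) \<in> B}"
        by (simp add: indicator_def)
    qed
    finally show "(\<integral>\<^sup>+s. h (s, mark X L T 1 \<omega>) \<partial>epoch_measure)
        = (\<Sum>j=1..L 1 \<omega>. emeasure epoch_measure {x. x + (X 1 \<omega> + T 1 j \<omega>) \<in> B})" .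
  qed
  finally show ?thesis by (simp add: c_def epoch_0)
qed

lemma first_cluster_le:
  assumes "integrable M (\<lambda>\<omega>. real (L 0 \<omega>))"
  shows "(\<integral>\<^sup>+\<omega>. (\<Sum>j=1..L 0 \<omega>. indicator B (X 0 \<omega> + T 0 j \<omega>)) \<partial>M) \<le> ennreal (expectation (\<lambda>\<omega>. real (L 0 \<omega>)))"
proof -
  have "(\<integral>\<^sup>+\<omega>. (\<Sum>j=1..L 0 \<omega>. indicator B (X 0 \<omega> + T 0 j \<omega>)) \<partial>M) \<le> (\<integral>\<^sup>+\<omega>. ennreal (real (L 0 \<omega>)) \<partial>M)"
  proof (rule nn_integral_mono)
    fix \<omega>
    have "(\<Sum>j=1..L 0 \<omega>. indicator B (X 0 \<omega> + T 0 j \<omega>)) \<le> (\<Sum>j=1..L 0 \<omega>. 1 :: ennreal)"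
      by (intro sum_mono) (auto simp: indicator_def)
    then show "(\<Sum>j=1..L 0 \<omega>. indicator B (X 0 \<omega> + T 0 j \<omega>)) \<le> ennreal (real (L 0 \<omega>))"
      by (simp add: ennreal_of_nat_eq_real_of_nat)
  qed
  also have "\<dots> = ennreal (expectation (\<lambda>\<omega>. real (L 0 \<omega>)))"
    by (intro nn_integral_eq_integral assms) auto
  finally show ?thesis .
qed

lemma abs_point_le_cluster_radius:
  assumes "j \<in> {1..L i \<omega>}"
  shows "\<bar>T i j \<omega>\<bar> \<le> cluster_radius L T i \<omega>"
proof -
  have "\<bar>T i j \<omega>\<bar> \<le> (SUP j\<in>{1..L i \<omega>}. \<bar>T i j \<omega>\<bar>)"
    using assms by (intro cSUP_upper) auto
  then show ?thesis using assms by (auto simp: cluster_radius_def)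
qed

context
  assumes L0_integrable: "integrable M (\<lambda>\<omega>. real (L 0 \<omega>))"
    and L1_integrable: "integrable M (\<lambda>\<omega>. real (L 1 \<omega>))"
begin

lemma intensity_interval_bound:
  assumes h: "h > 0"
  shows "\<exists>K. \<forall>t. emeasure intensity_measure {t - h<..t} \<le> ennreal K"
proof -
  obtain C where C: "C \<ge> 0" "\<And>t h. h \<ge> 0 \<Longrightarrow> emeasure epoch_measure {t - h<..t} \<le> ennreal (C * (1 + h))"
    using renewal.W_interval_bound by blast
  have "emeasure intensity_measure {t - h<..t}
      \<le> ennreal (expectation (\<lambda>\<omega>. real (L 0 \<omega>)) + expectation (\<lambda>\<omega>. real (L 1 \<omega>) * (C * (1 + h))))" for t
  proof -
    have "(\<integral>\<^sup>+\<omega>. (\<Sum>j=1..L 1 \<omega>. emeasure epoch_measure {x. x + (X 1 \<omega> + T 1 j \<omega>) \<in> {t - h<..t}}) \<partial>M)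
        \<le> (\<integral>\<^sup>+\<omega>. ennreal (real (L 1 \<omega>) * (C * (1 + h))) \<partial>M)"
    proof (rule nn_integral_mono)
      fix \<omega>
      have "emeasure epoch_measure {x. x + c \<in> {t - h<..t}} \<le> ennreal (C * (1 + h))" for c
      proof -
        have "{x. x + c \<in> {t - h<..t}} = {(t - c) - h<..t - c}" by auto
        then show ?thesis using C(2)[of h "t - c"] h by simp
      qed
      then have "(\<Sum>j=1..L 1 \<omega>. emeasure epoch_measure {x. x + (X 1 \<omega> + T 1 j \<omega>) \<in> {t - h<..t}})
          \<le> (\<Sum>j=1..L 1 \<omega>. ennreal (C * (1 + h)))"
        by (intro sum_mono)
      also have "\<dots> = ennreal (real (L 1 \<omega>) * (C * (1 + h)))"
        using C h by (subst ennreal_mult) (auto simp: ennreal_of_nat_eq_real_of_nat)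
      finally show "(\<Sum>j=1..L 1 \<omega>. emeasure epoch_measure {x. x + (X 1 \<omega> + T 1 j \<omega>) \<in> {t - h<..t}})
          \<le> ennreal (real (L 1 \<omega>) * (C * (1 + h)))" .
    qed
    also have "\<dots> = ennreal (expectation (\<lambda>\<omega>. real (L 1 \<omega>) * (C * (1 + h))))"
      using C h L1_integrable by (intro nn_integral_eq_integral) auto
    finally show ?thesis
      using C h first_cluster_le[OF L0_integrable, of "{t - h<..t}"]
      by (subst emeasure_intensity_decomposition) (auto simp: ennreal_plus intro!: add_mono)
  qed
  then show ?thesis by blast
qed

text \<open>
  Blackwell's theorem applies to each translated window \<open>t - (X 1 + T 1 j)\<close>, and window masses are
  bounded uniformly in the position, so the integrand is dominated by a multiple of \<open>L 1\<close>. The window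
  eventually leaves every point of the initial cluster behind.
\<close>

lemma intensity_blackwell:
  assumes h: "h > 0"
  shows "((\<lambda>t. emeasure intensity_measure {t - h<..t})
    \<longlongrightarrow> ennreal (h * (1 / expectation (X 1) * expectation (\<lambda>\<omega>. real (L 1 \<omega>))))) at_top"
proof -
  obtain C where C: "C \<ge> 0" "\<And>t h. h \<ge> 0 \<Longrightarrow> emeasure epoch_measure {t - h<..t} \<le> ennreal (C * (1 + h))"
    using renewal.W_interval_bound by blast
  define K where "K = C * (1 + h)"
  have K: "K \<ge> 0" using C h by (simp add: K_def)
  define w where "w t = measure epoch_measure {t - h<..t}" for t
  have w_nonneg: "w t \<ge> 0" for t by (simp add: w_def)
  have w_le: "w t \<le> K" for t
    using C(2)[of h t] h K unfolding w_def measure_def K_def by (intro enn2real_leI) auto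
  have w_emeasure: "emeasure epoch_measure {t - h<..t} = ennreal (w t)" for t
    using renewal.W_interval_finite[of "t - h" t] by (simp add: w_def emeasure_eq_ennreal_measure)
  have w_lim: "(w \<longlongrightarrow> h / expectation (X 1)) at_top"
    unfolding w_def using renewal.blackwell[OF h] unfolding integral_increment_distr .
  have [measurable]: "w \<in> borel_measurable borel"
  proof -
    have "w = (\<lambda>t. measure epoch_measure {..t} - measure epoch_measure {..t - h})"
    proof
      fix t
      have "measure epoch_measure ({..t} - {..t - h}) = measure epoch_measure {..t} - measure epoch_measure {..t - h}"
        using epoch_measure_finite[of t] h by (intro measure_Diff) (auto simp: sets_epoch_measure)
      moreover have "{..t} - {..t - h} = {t - h<..t}" by auto
      ultimately show "w t = measure epoch_measure {..t} - measure epoch_measure {..t - h}"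
        by (simp add: w_def)
    qed
    moreover have mono: "mono (\<lambda>t. measure epoch_measure {..t})"
      unfolding mono_def using epoch_measure_finite
      by (auto intro!: measure_mono_fmeasurable simp: fmeasurable_def sets_epoch_measure)
    ultimately show ?thesis
      using borel_measurable_mono[OF mono]
        measurable_compose[OF _ borel_measurable_mono[OF mono], of "\<lambda>t. t - h" borel] by simp
  qed
  define first where "first t \<omega> = (\<Sum>j=1..L 0 \<omega>. indicator {t - h<..t} (X 0 \<omega> + T 0 j \<omega>) :: real)" for t \<omega>
  define later where "later t \<omega> = (\<Sum>j=1..L 1 \<omega>. w (t - (X 1 \<omega> + T 1 j \<omega>)))" for t \<omega>
  have first_meas: "first t \<in> borel_measurable M" for t
    unfolding first_def
  proof (rule borel_measurable_sum_upto_random[OF L_measurable])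
    fix j :: nat assume "j \<ge> 1"
    note [measurable] = T_measurable[OF this]
    show "(\<lambda>\<omega>. indicator {t - h<..t} (X 0 \<omega> + T 0 j \<omega>) :: real) \<in> borel_measurable M" by measurable
  qed
  have later_meas: "later t \<in> borel_measurable M" for t
    unfolding later_def
  proof (rule borel_measurable_sum_upto_random[OF L_measurable])
    fix j :: nat assume "j \<ge> 1"
    note [measurable] = T_measurable[OF this]
    show "(\<lambda>\<omega>. w (t - (X 1 \<omega> + T 1 j \<omega>))) \<in> borel_measurable M" by measurable
  qed
  have first_nonneg: "first t \<omega> \<ge> 0" for t \<omega> unfolding first_def by (intro sum_nonneg) auto
  have later_nonneg: "later t \<omega> \<ge> 0" for t \<omega> unfolding later_def by (intro sum_nonneg w_nonneg)
  have first_le: "first t \<omega> \<le> real (L 0 \<omega>)" for t \<omega>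
    using sum_mono[of "{1..L 0 \<omega>}" "\<lambda>j. indicator {t - h<..t} (X 0 \<omega> + T 0 j \<omega>) :: real" "\<lambda>_. 1"]
    unfolding first_def by (auto simp: indicator_def)
  have later_le: "later t \<omega> \<le> real (L 1 \<omega>) * K" for t \<omega>
    using sum_mono[of "{1..L 1 \<omega>}" "\<lambda>j. w (t - (X 1 \<omega> + T 1 j \<omega>))" "\<lambda>_. K"] w_le
    unfolding later_def by auto
  have first_int: "integrable M (first t)" for t
    by (rule Bochner_Integration.integrable_bound[OF L0_integrable first_meas])
      (use first_nonneg first_le in auto)
  have LK: "integrable M (\<lambda>\<omega>. real (L 1 \<omega>) * K)" using L1_integrable by simp
  have later_int: "integrable M (later t)" for t
    by (rule Bochner_Integration.integrable_bound[OF LK later_meas])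
      (use later_nonneg later_le K in auto)
  have U_eq: "emeasure intensity_measure {t - h<..t} = ennreal (expectation (first t) + expectation (later t))" for t
  proof -
    have "(\<integral>\<^sup>+\<omega>. (\<Sum>j=1..L 0 \<omega>. indicator {t - h<..t} (X 0 \<omega> + T 0 j \<omega>)) \<partial>M) = (\<integral>\<^sup>+\<omega>. ennreal (first t \<omega>) \<partial>M)"
      unfolding first_def 
      by (intro nn_integral_cong, subst sum_ennreal[symmetric]) (simp_all only: ennreal_indicator indicator_pos_le)
    also have "\<dots> = ennreal (expectation (first t))"
      by (intro nn_integral_eq_integral first_int) (simp add: first_nonneg)
    finally have 1: "(\<integral>\<^sup>+\<omega>. (\<Sum>j=1..L 0 \<omega>. indicator {t - h<..t} (X 0 \<omega> + T 0 j \<omega>)) \<partial>M)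
        = ennreal (expectation (first t))" .
    have "{x. x + c \<in> {t - h<..t}} = {(t - c) - h<..t - c}" for c by auto
    then have "(\<integral>\<^sup>+\<omega>. (\<Sum>j=1..L 1 \<omega>. emeasure epoch_measure {x. x + (X 1 \<omega> + T 1 j \<omega>) \<in> {t - h<..t}}) \<partial>M)
        = (\<integral>\<^sup>+\<omega>. ennreal (later t \<omega>) \<partial>M)"
      unfolding later_def by (simp only: w_emeasure sum_ennreal[OF w_nonneg])
    also have "\<dots> = ennreal (expectation (later t))"
      by (intro nn_integral_eq_integral later_int) (simp add: later_nonneg)
    finally have 2: "(\<integral>\<^sup>+\<omega>. (\<Sum>j=1..L 1 \<omega>. emeasure epoch_measure {x. x + (X 1 \<omega> + T 1 j \<omega>) \<in> {t - h<..t}}) \<partial>M)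
        = ennreal (expectation (later t))" .
    have "expectation (first t) \<ge> 0" "expectation (later t) \<ge> 0"
      using first_nonneg later_nonneg by simp_all
    with 1 2 show ?thesis by (subst emeasure_intensity_decomposition) auto
  qed
  have lim_first: "((\<lambda>t. expectation (first t)) \<longlongrightarrow> expectation (\<lambda>_. 0)) at_top"
  proof (rule integral_dominated_convergence_at_top[where w = "\<lambda>\<omega>. real (L 0 \<omega>)"])
    show "AE \<omega> in M. ((\<lambda>t. first t \<omega>) \<longlongrightarrow> 0) at_top"
    proof (rule AE_I2)
      fix \<omega>
      have "((\<lambda>t. indicator {t - h<..t} x :: real) \<longlongrightarrow> 0) at_top" for x
      proof (rule tendsto_eventually)
        show "eventually (\<lambda>t. indicator {t - h<..t} x = (0 :: real)) at_top"
          using eventually_ge_at_top[of "x + h"] by eventually_elim auto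
      qed
      then have "((\<lambda>t. first t \<omega>) \<longlongrightarrow> (\<Sum>j=1..L 0 \<omega>. 0)) at_top"
        unfolding first_def by (intro tendsto_sum)
      then show "((\<lambda>t. first t \<omega>) \<longlongrightarrow> 0) at_top" by simp
    qed
  qed (use first_meas L0_integrable first_nonneg first_le in auto)
  have lim_later: "((\<lambda>t. expectation (later t)) \<longlongrightarrow> expectation (\<lambda>\<omega>. real (L 1 \<omega>) * (h / expectation (X 1)))) at_top"
  proof (rule integral_dominated_convergence_at_top[where w = "\<lambda>\<omega>. real (L 1 \<omega>) * K"])
    show "AE \<omega> in M. ((\<lambda>t. later t \<omega>) \<longlongrightarrow> real (L 1 \<omega>) * (h / expectation (X 1))) at_top"
    proof (rule AE_I2)
      fix \<omega>
      have "((\<lambda>t. w (t - c)) \<longlongrightarrow> h / expectation (X 1)) at_top" for c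
        using filterlim_compose[OF w_lim filterlim_minus_const_at_top[of c]] .
      then have "((\<lambda>t. later t \<omega>) \<longlongrightarrow> (\<Sum>j=1..L 1 \<omega>. h / expectation (X 1))) at_top"
        unfolding later_def by (intro tendsto_sum)
      then show "((\<lambda>t. later t \<omega>) \<longlongrightarrow> real (L 1 \<omega>) * (h / expectation (X 1))) at_top" by simp
    qed
  qed (use later_meas LK later_nonneg later_le in auto)
  have "((\<lambda>t. expectation (first t) + expectation (later t))
      \<longlongrightarrow> h * (1 / expectation (X 1) * expectation (\<lambda>\<omega>. real (L 1 \<omega>)))) at_top"
    using tendsto_add[OF lim_first lim_later] by (simp add: mult.commute)
  then show ?thesis unfolding U_eq by (rule tendsto_ennrealI)
qed

text \<open>
  The epoch measure of \<open>{..s}\<close> grows at most linearly in \<open>s\<close>, and a point displaced by at most the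
  cluster radius \<open>R\<close> to the left can enter \<open>{..t}\<close> only from an epoch below \<open>\<bar>t\<bar> + R\<close>. The expected number of
  points in \<open>{..t}\<close> is thus controlled by the means of \<open>L 1\<close> and \<open>L 1 * R\<close>.
\<close>

lemma intensity_finite:
  assumes LR: "integrable M (\<lambda>\<omega>. real (L 1 \<omega>) * cluster_radius L T 1 \<omega>)"
  shows "emeasure intensity_measure {..t} < \<infinity>"
proof -
  obtain C where C: "C \<ge> 0" "\<And>t h. h \<ge> 0 \<Longrightarrow> emeasure epoch_measure {t - h<..t} \<le> ennreal (C * (1 + h))"
    using renewal.W_interval_bound by blast
  define w0 where "w0 = measure epoch_measure {..0}"
  have linear: "emeasure epoch_measure {..s} \<le> ennreal (w0 + C * (1 + s))" if s: "s \<ge> 0" for s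
  proof -
    have "emeasure epoch_measure {..s} = emeasure epoch_measure ({..0} \<union> {s - s<..s})"
      using s by (intro arg_cong[where f = "emeasure epoch_measure"]) auto
    also have "\<dots> \<le> emeasure epoch_measure {..0} + emeasure epoch_measure {s - s<..s}"
      by (intro emeasure_subadditive) (auto simp: sets_epoch_measure)
    also have "\<dots> \<le> ennreal w0 + ennreal (C * (1 + s))"
      using C(2)[OF s, of s] epoch_measure_finite[of 0]
      by (intro add_mono) (auto simp: w0_def emeasure_eq_ennreal_measure)
    also have "\<dots> = ennreal (w0 + C * (1 + s))"
      using C s by (simp add: w0_def)
    finally show ?thesis .
  qed
  let ?b = "\<lambda>\<omega>. real (L 1 \<omega>) * (w0 + C * (1 + \<bar>t\<bar>)) + C * (real (L 1 \<omega>) * cluster_radius L T 1 \<omega>)"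
  have "(\<integral>\<^sup>+\<omega>. (\<Sum>j=1..L 1 \<omega>. emeasure epoch_measure {x. x + (X 1 \<omega> + T 1 j \<omega>) \<in> {..t}}) \<partial>M)
      \<le> (\<integral>\<^sup>+\<omega>. ennreal (?b \<omega>) \<partial>M)"
  proof (rule nn_integral_mono)
    fix \<omega> assume \<omega>: "\<omega> \<in> space M"
    let ?s = "\<bar>t\<bar> + cluster_radius L T 1 \<omega>"
    have "(\<Sum>j=1..L 1 \<omega>. emeasure epoch_measure {x. x + (X 1 \<omega> + T 1 j \<omega>) \<in> {..t}})
        \<le> (\<Sum>j=1..L 1 \<omega>. ennreal (w0 + C * (1 + ?s)))"
    proof (rule sum_mono)
      fix j assume j: "j \<in> {1..L 1 \<omega>}"
      note R = abs_point_le_cluster_radius[OF j]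
      have "emeasure epoch_measure {x. x + (X 1 \<omega> + T 1 j \<omega>) \<in> {..t}} \<le> emeasure epoch_measure {..?s}"
        using R increment_nonneg[OF \<omega>, of 1] by (intro emeasure_mono) (auto simp: sets_epoch_measure)
      also have "\<dots> \<le> ennreal (w0 + C * (1 + ?s))" using R by (intro linear) auto
      finally show "emeasure epoch_measure {x. x + (X 1 \<omega> + T 1 j \<omega>) \<in> {..t}} \<le> ennreal (w0 + C * (1 + ?s))" .
    qed
    also have "\<dots> = ennreal (real (L 1 \<omega>)) * ennreal (w0 + C * (1 + ?s))"
      by (simp add: ennreal_of_nat_eq_real_of_nat)
    also have "\<dots> = ennreal (?b \<omega>)"
      by (subst ennreal_mult'[symmetric]) (auto simp: algebra_simps)
    finally show "(\<Sum>j=1..L 1 \<omega>. emeasure epoch_measure {x. x + (X 1 \<omega> + T 1 j \<omega>) \<in> {..t}}) \<le> ennreal (?b \<omega>)" .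
  qed
  also have "\<dots> < \<infinity>"
  proof -
    have "integrable M ?b" using L1_integrable LR by (intro Bochner_Integration.integrable_add) auto
    then have "(\<integral>\<^sup>+\<omega>. ennreal (norm (?b \<omega>)) \<partial>M) < \<infinity>" by (simp only: integrable_iff_bounded)
    moreover have "(\<integral>\<^sup>+\<omega>. ennreal (?b \<omega>) \<partial>M) \<le> (\<integral>\<^sup>+\<omega>. ennreal (norm (?b \<omega>)) \<partial>M)"
      by (intro nn_integral_mono ennreal_leI) simp
    ultimately show ?thesis by (rule le_less_trans[rotated])
  qed
  finally show ?thesis
    using first_cluster_le[OF L0_integrable, of "{..t}"]
    by (subst emeasure_intensity_decomposition) (auto simp: less_top[symmetric] top_unique)
qed

text \<open>
  A Borel measure that is finite on the half-lines \<open>{..t}\<close> is determined by its values there.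
\<close>

lemma renewal_measure_eq_intensity_measure:
  assumes "integrable M (\<lambda>\<omega>. real (L 1 \<omega>) * cluster_radius L T 1 \<omega>)"
  shows "renewal_measure M X L T = intensity_measure"
  unfolding renewal_measure_def
proof (rule the_equality)
  show "sets intensity_measure = sets borel \<and> (\<forall>t. emeasure intensity_measure {..t} = renewal_fun M X L T t)"
    by (auto simp: sets_intensity_measure emeasure_intensity_measure renewal_fun_def)
  fix U :: "real measure"
  assume U: "sets U = sets borel \<and> (\<forall>t. emeasure U {..t} = renewal_fun M X L T t)"
  show "U = intensity_measure"
  proof (rule measure_eqI_generator_eq[where E = "range (\<lambda>t. {..t})" and \<Omega> = UNIV and A = "\<lambda>n. {..real n}"])
    show "Int_stable (range (\<lambda>t::real. {..t}))"
      by (auto simp: Int_stable_def)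
    have borel: "sets borel = sigma_sets UNIV (range (\<lambda>t::real. {..t}))"
      by (subst borel_eq_atMost) simp
    show "sets U = sigma_sets UNIV (range (\<lambda>t. {..t}))" using U borel by simp
    show "sets intensity_measure = sigma_sets UNIV (range (\<lambda>t. {..t}))"
      using borel by (simp add: sets_intensity_measure)
    fix Y assume "Y \<in> range (\<lambda>t::real. {..t})"
    then show "emeasure U Y = emeasure intensity_measure Y"
      using U by (auto simp: emeasure_intensity_measure renewal_fun_def)
  next
    fix n
    show "emeasure U {..real n} \<noteq> \<infinity>"
      using U intensity_finite[OF assms, of "real n"]
      by (simp add: emeasure_intensity_measure renewal_fun_def)
  qed (auto intro: real_arch_simple)
qed

end

end

section \<open>From Blackwell to directly Riemann integrable functions\<close>

text \<open>
  Dominated convergence for series, in the form of an integral over counting measure.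
\<close>

lemma ennreal_series_tendsto:
  fixes c :: "nat \<Rightarrow> ennreal"
  assumes c: "(\<Sum>k. c k) < \<infinity>" and K: "K < \<infinity>"
    and bound: "\<And>n k. a n k \<le> K" and lim: "\<And>k. (\<lambda>n. a n k) \<longlonglongrightarrow> l k"
  shows "(\<lambda>n. \<Sum>k. c k * a n k) \<longlonglongrightarrow> (\<Sum>k. c k * l k)"
proof -
  have c_fin: "c k < top" for k
  proof -
    have "c k \<le> (\<Sum>k. c k)" using sum_le_suminf[of c "{k}"] by simp
    then show ?thesis using c by (simp add: le_less_trans)
  qed
  have "(\<lambda>n. \<integral>\<^sup>+k. c k * a n k \<partial>count_space UNIV) \<longlonglongrightarrow> (\<integral>\<^sup>+k. c k * l k \<partial>count_space UNIV)"
  proof (rule nn_integral_dominated_convergence[where w = "\<lambda>k. c k * K"])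
    show "(\<integral>\<^sup>+k. c k * K \<partial>count_space UNIV) < \<infinity>"
      using c K by (simp add: nn_integral_count_space_nat ennreal_mult_less_top)
  qed (use c_fin in \<open>auto intro!: mult_left_mono bound ennreal_tendsto_cmult lim\<close>)
  then show ?thesis by (simp add: nn_integral_count_space_nat)
qed

definition cell :: "real \<Rightarrow> nat \<Rightarrow> real set" where
  "cell h k = {real k * h..<real (Suc k) * h}"

lemma cells_disjoint: "h > 0 \<Longrightarrow> disjoint_family (cell h)"
proof (unfold disjoint_family_on_def, intro ballI impI)
  fix i j :: nat assume h: "h > 0" and "i \<noteq> j"
  have "cell h i \<inter> cell h j = {}" if "i < j" for i j :: nat
  proof -
    have "real (Suc i) * h \<le> real j * h" using that h by (intro mult_right_mono) auto
    then show ?thesis by (auto simp: cell_def)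
  qed
  with \<open>i \<noteq> j\<close> show "cell h i \<inter> cell h j = {}" by (metis inf_commute nat_neq_iff)
qed

lemma cells_cover:
  assumes "h > 0" "x \<ge> 0"
  shows "\<exists>k. x \<in> cell h k"
proof -
  define k where "k = nat \<lfloor>x / h\<rfloor>"
  have "x / h \<ge> 0" using assms by simp
  then have "real k = of_int \<lfloor>x / h\<rfloor>" by (simp add: k_def)
  then have "real k \<le> x / h" "x / h < real k + 1" by linarith+
  then have "x \<in> cell h k" using assms by (auto simp: cell_def field_simps)
  then show ?thesis ..
qed

definition cell_sup :: "(real \<Rightarrow> real) \<Rightarrow> real \<Rightarrow> nat \<Rightarrow> ennreal" where
  "cell_sup g h k = (SUP y\<in>cell h k. ennreal (g y))"

definition cell_inf :: "(real \<Rightarrow> real) \<Rightarrow> real \<Rightarrow> nat \<Rightarrow> ennreal" where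
  "cell_inf g h k = (INF y\<in>cell h k. ennreal (g y))"

lemma cell_inf_le_sup:
  assumes "h > 0"
  shows "cell_inf g h k \<le> cell_sup g h k"
proof -
  have "real k * h \<in> cell h k" using assms by (simp add: cell_def)
  then show ?thesis
    unfolding cell_inf_def cell_sup_def by (metis INF_lower SUP_upper order_trans)
qed

lemma upper_step_bound:
  assumes "h > 0"
  shows "ennreal (g x) * indicator {0..} x \<le> (\<Sum>k. cell_sup g h k * indicator (cell h k) x)"
proof (cases "x \<ge> 0")
  case True
  then obtain k where k: "x \<in> cell h k" using cells_cover assms by blast
  have "(\<Sum>k. cell_sup g h k * indicator (cell h k) x) = cell_sup g h k"
    by (rule suminf_cmult_indicator[OF cells_disjoint[OF assms] k])
  moreover have "ennreal (g x) \<le> cell_sup g h k" unfolding cell_sup_def using k by (rule SUP_upper)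
  ultimately show ?thesis using True by simp
qed simp

lemma lower_step_bound:
  assumes "h > 0"
  shows "(\<Sum>k. cell_inf g h k * indicator (cell h k) x) \<le> ennreal (g x) * indicator {0..} x"
proof (cases "x \<ge> 0")
  case True
  then obtain k where k: "x \<in> cell h k" using cells_cover assms by blast
  have "(\<Sum>k. cell_inf g h k * indicator (cell h k) x) = cell_inf g h k"
    by (rule suminf_cmult_indicator[OF cells_disjoint[OF assms] k])
  moreover have "cell_inf g h k \<le> ennreal (g x)" unfolding cell_inf_def using k by (rule INF_lower)
  ultimately show ?thesis using True by simp
next
  case False
  have "x \<notin> cell h k" for k
  proof -
    have "real k * h \<ge> 0" using assms by simp
    then show ?thesis using False unfolding cell_def by auto
  qed
  then show ?thesis by simp
qed

lemma nn_integral_step: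
  assumes "h > 0"
  shows "(\<integral>\<^sup>+x. (\<Sum>k. c k * indicator (cell h k) x) \<partial>lebesgue) = ennreal h * (\<Sum>k. c k)"
proof -
  have "(\<integral>\<^sup>+x. (\<Sum>k. c k * indicator (cell h k) x) \<partial>lebesgue) = (\<Sum>k. \<integral>\<^sup>+x. c k * indicator (cell h k) x \<partial>lebesgue)"
    by (rule nn_integral_suminf, rule borel_measurable_times_ennreal)
      (auto simp: cell_def intro!: borel_measurable_indicator)
  also have "\<dots> = (\<Sum>k. c k * ennreal h)"
  proof (rule suminf_cong)
    fix k
    have "emeasure lebesgue (cell h k) = ennreal h"
      unfolding cell_def using assms by (subst emeasure_completion) (auto simp: algebra_simps)
    then show "(\<integral>\<^sup>+x. c k * indicator (cell h k) x \<partial>lebesgue) = c k * ennreal h"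
      by (subst nn_integral_cmult_indicator) (auto simp: cell_def)
  qed
  finally show ?thesis by (simp add: mult.commute)
qed

text \<open>
  The integral lies between the lower and the upper sum for every mesh, and these approach each other.
\<close>

lemma riemann_sum_limits:
  assumes dri: "directly_riemann_integrable g"
  defines "J \<equiv> (\<integral>\<^sup>+y\<in>{0..}. ennreal (g y) \<partial>lebesgue)"
  shows "J < \<infinity>" "(upper_riemann_sum g \<longlongrightarrow> J) (at_right 0)" "(lower_riemann_sum g \<longlongrightarrow> J) (at_right 0)"
proof -
  have upper: "upper_riemann_sum g h = ennreal h * (\<Sum>k. cell_sup g h k)" for h
    by (simp add: upper_riemann_sum_def cell_sup_def cell_def)
  have lower: "lower_riemann_sum g h = ennreal h * (\<Sum>k. cell_inf g h k)" for h
    by (simp add: lower_riemann_sum_def cell_inf_def cell_def)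
  have J_le: "J \<le> upper_riemann_sum g h" if "h > 0" for h
    unfolding J_def upper nn_integral_step[OF that, symmetric]
    by (intro nn_integral_mono upper_step_bound that)
  have le_J: "lower_riemann_sum g h \<le> J" if "h > 0" for h
    unfolding J_def lower nn_integral_step[OF that, symmetric]
    by (intro nn_integral_mono lower_step_bound that)
  show J_fin: "J < \<infinity>"
    using J_le[of 1] dri unfolding directly_riemann_integrable_def by (metis le_less_trans zero_less_one)
  define d where "d h = upper_riemann_sum g h - lower_riemann_sum g h" for h
  have d: "(d \<longlongrightarrow> 0) (at_right 0)"
    using dri unfolding directly_riemann_integrable_def d_def by blast
  have split: "upper_riemann_sum g h = lower_riemann_sum g h + d h" if "h > 0" for h
  proof -
    have "lower_riemann_sum g h \<le> upper_riemann_sum g h" using le_J[OF that] J_le[OF that] by (rule order_trans)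
    then show ?thesis unfolding d_def by (rule ennreal_ineq_diff_add)
  qed
  have pos: "eventually (\<lambda>h::real. h > 0) (at_right 0)"
    by (simp add: eventually_at_right_less)
  show "(upper_riemann_sum g \<longlongrightarrow> J) (at_right 0)"
  proof (rule tendsto_sandwich)
    show "eventually (\<lambda>h. J \<le> upper_riemann_sum g h) (at_right 0)"
      using pos by eventually_elim (rule J_le)
    show "eventually (\<lambda>h. upper_riemann_sum g h \<le> J + d h) (at_right 0)"
      using pos by eventually_elim (auto simp: split intro!: add_right_mono le_J)
    show "((\<lambda>h. J + d h) \<longlongrightarrow> J) (at_right 0)"
      using tendsto_add[OF tendsto_const d, of J] by simp
  qed simp
  show "(lower_riemann_sum g \<longlongrightarrow> J) (at_right 0)"
  proof (rule tendsto_sandwich)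
    show "eventually (\<lambda>h. lower_riemann_sum g h \<le> J) (at_right 0)"
      using pos by eventually_elim (rule le_J)
    show "eventually (\<lambda>h. J - d h \<le> lower_riemann_sum g h) (at_right 0)"
      using pos
    proof eventually_elim
      case (elim h)
      have "J \<le> d h + lower_riemann_sum g h" using J_le[OF elim] split[OF elim] by (simp add: add.commute)
      then show ?case using J_fin by (auto simp: ennreal_minus_le_iff)
    qed
    show "((\<lambda>h. J - d h) \<longlongrightarrow> J) (at_right 0)"
      using tendsto_diff_ennreal[OF tendsto_const d, of J] J_fin by simp
  qed simp
qed

text \<open>
  On a mesh \<open>h\<close>, the function \<open>g\<close> lies between the step functions of its infima and suprema over the
  cells. Since \<open>nn_integral\<close> is monotone for arbitrary functions, the integral in question lies between two
  series whose terms are a cell value times the \<open>U\<close>-mass of a window of length \<open>h\<close>. The window masses converge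
  and are bounded, so these series converge to \<open>\<kappa>\<close> times the lower and the upper Riemann sum, which have
  a common limit as \<open>h\<close> tends to 0.
\<close>

lemma key_renewal_from_local_limit:
  fixes U :: "real measure"
  assumes sets_U [measurable_cong]: "sets U = sets borel"
    and bound: "\<And>h. h > 0 \<Longrightarrow> \<exists>K. \<forall>t. emeasure U {t - h<..t} \<le> ennreal K"
    and lim: "\<And>h. h > 0 \<Longrightarrow> ((\<lambda>t. emeasure U {t - h<..t}) \<longlongrightarrow> ennreal (h * \<kappa>)) at_top"
    and dri: "directly_riemann_integrable g"
  shows "((\<lambda>t. \<integral>\<^sup>+y\<in>{0<..t}. ennreal (g (t - y)) \<partial>U) \<longlongrightarrow>
    ennreal \<kappa> * (\<integral>\<^sup>+y\<in>{0..}. ennreal (g y) \<partial>lebesgue)) at_top"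
proof (rule tendsto_at_topI_sequentially)
  fix \<tau> :: "nat \<Rightarrow> real" assume \<tau>: "filterlim \<tau> at_top sequentially"
  define J where "J = (\<integral>\<^sup>+y\<in>{0..}. ennreal (g y) \<partial>lebesgue)"
  define I where "I n = (\<integral>\<^sup>+y\<in>{0<..\<tau> n}. ennreal (g (\<tau> n - y)) \<partial>U)" for n
  note limits = riemann_sum_limits[OF dri, folded J_def]
  define u where "u h n k = emeasure U {\<tau> n - real k * h - h<..\<tau> n - real k * h}" for h n k
  have shifted_cell: "(indicator (cell h k) (t - y) :: ennreal) = indicator {t - real k * h - h<..t - real k * h} y" for h k t y
    by (auto simp: cell_def indicator_def algebra_simps)
  have u_lim: "(\<lambda>n. u h n k) \<longlonglongrightarrow> ennreal h * ennreal \<kappa>" if "h > 0" for h k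
  proof -
    have "filterlim (\<lambda>n. \<tau> n - real k * h) at_top sequentially"
      using filterlim_compose[OF filterlim_minus_const_at_top \<tau>] .
    from filterlim_compose[OF lim[OF that] this] that show ?thesis
      unfolding u_def by (simp add: ennreal_mult')
  qed
  have sup_finite: "(\<Sum>k. cell_sup g h k) < \<infinity>" if "h > 0" for h
  proof -
    have "ennreal h * (\<Sum>k. cell_sup g h k) < \<infinity>"
      using dri that unfolding directly_riemann_integrable_def upper_riemann_sum_def cell_sup_def cell_def by blast
    then show ?thesis using that by (auto simp: ennreal_mult_less_top)
  qed
  have inf_finite: "(\<Sum>k. cell_inf g h k) < \<infinity>" if "h > 0" for h
    using sup_finite[OF that] suminf_le[of "cell_inf g h" "cell_sup g h"] cell_inf_le_sup[OF that]
    by (auto intro: le_less_trans)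
  have scale: "(\<Sum>k. c k * (ennreal h * ennreal \<kappa>)) = ennreal \<kappa> * (ennreal h * (\<Sum>k. c k))" for c :: "nat \<Rightarrow> ennreal" and h
    by (simp add: mult_ac)
  have upper: "Limsup sequentially I \<le> ennreal \<kappa> * upper_riemann_sum g h" if h: "h > 0" for h
  proof -
    obtain K where K: "\<And>t. emeasure U {t - h<..t} \<le> ennreal K" using bound[OF h] by blast
    have "I n \<le> (\<Sum>k. cell_sup g h k * u h n k)" for n
    proof -
      have "I n \<le> (\<integral>\<^sup>+y. (\<Sum>k. cell_sup g h k * indicator (cell h k) (\<tau> n - y)) \<partial>U)"
        unfolding I_def
      proof (rule nn_integral_mono)
        fix y
        have "ennreal (g (\<tau> n - y)) * indicator {0<..\<tau> n} y \<le> ennreal (g (\<tau> n - y)) * indicator {0..} (\<tau> n - y)"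
          by (auto simp: indicator_def)
        also have "\<dots> \<le> (\<Sum>k. cell_sup g h k * indicator (cell h k) (\<tau> n - y))"
          by (rule upper_step_bound[OF h])
        finally show "ennreal (g (\<tau> n - y)) * indicator {0<..\<tau> n} y \<le> \<dots>" .
      qed
      also have "\<dots> = (\<Sum>k. \<integral>\<^sup>+y. cell_sup g h k * indicator (cell h k) (\<tau> n - y) \<partial>U)"
        unfolding shifted_cell by (rule nn_integral_suminf) measurable
      also have "\<dots> = (\<Sum>k. cell_sup g h k * u h n k)"
        unfolding shifted_cell u_def
        by (intro suminf_cong nn_integral_cmult_indicator) (simp add: sets_U)
      finally show ?thesis .
    qed
    then have "Limsup sequentially I \<le> Limsup sequentially (\<lambda>n. \<Sum>k. cell_sup g h k * u h n k)"
      by (intro Limsup_mono always_eventually allI)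
    also have "\<dots> = (\<Sum>k. cell_sup g h k * (ennreal h * ennreal \<kappa>))"
      by (intro lim_imp_Limsup ennreal_series_tendsto[where K = "ennreal K"] sup_finite h u_lim)
        (auto simp: u_def K)
    also have "\<dots> = ennreal \<kappa> * upper_riemann_sum g h"
      unfolding scale upper_riemann_sum_def cell_sup_def cell_def ..
    finally show ?thesis .
  qed
  have lower: "ennreal \<kappa> * lower_riemann_sum g h \<le> Liminf sequentially I" if h: "h > 0" for h
  proof -
    obtain K where K: "\<And>t. emeasure U {t - h<..t} \<le> ennreal K" using bound[OF h] by blast
    \<comment> \<open>The cell with index \<open>k\<close> is dropped until its whole reflected window lies in \<open>{0<..\<tau> n}\<close>; for fixed
        \<open>k\<close> this changes finitely many terms of the sequence.\<close>
    define v where "v n k = (if real (Suc k) * h \<le> \<tau> n then u h n k else 0)" for n k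
    have v_lim: "(\<lambda>n. v n k) \<longlonglongrightarrow> ennreal h * ennreal \<kappa>" for k
    proof -
      have "eventually (\<lambda>n. real (Suc k) * h \<le> \<tau> n) sequentially"
        using \<tau> by (simp add: filterlim_at_top)
      then have "eventually (\<lambda>n. v n k = u h n k) sequentially"
        by eventually_elim (simp add: v_def)
      then show ?thesis using u_lim[OF h] by (simp add: tendsto_cong)
    qed
    have "(\<Sum>k. cell_inf g h k * v n k) \<le> I n" for n
    proof -
      define c where "c k = (if real (Suc k) * h \<le> \<tau> n then cell_inf g h k else 0)" for k
      have "(\<Sum>k. cell_inf g h k * v n k) = (\<Sum>k. c k * u h n k)"
        by (intro suminf_cong) (simp add: v_def c_def)
      also have "\<dots> = (\<Sum>k. \<integral>\<^sup>+y. c k * indicator (cell h k) (\<tau> n - y) \<partial>U)"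
        unfolding shifted_cell u_def
        by (intro suminf_cong nn_integral_cmult_indicator[symmetric]) (simp add: sets_U)
      also have "\<dots> = (\<integral>\<^sup>+y. (\<Sum>k. c k * indicator (cell h k) (\<tau> n - y)) \<partial>U)"
        unfolding shifted_cell by (rule nn_integral_suminf[symmetric]) measurable
      also have "\<dots> \<le> I n"
        unfolding I_def
      proof (rule nn_integral_mono)
        fix y
        show "(\<Sum>k. c k * indicator (cell h k) (\<tau> n - y)) \<le> ennreal (g (\<tau> n - y)) * indicator {0<..\<tau> n} y"
        proof (cases "y > 0")
          case True
          have "(\<Sum>k. c k * indicator (cell h k) (\<tau> n - y)) \<le> (\<Sum>k. cell_inf g h k * indicator (cell h k) (\<tau> n - y))"
            by (intro suminf_le) (auto simp: c_def)
          also have "\<dots> \<le> ennreal (g (\<tau> n - y)) * indicator {0..} (\<tau> n - y)"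
            by (rule lower_step_bound[OF h])
          finally show ?thesis using True by (auto simp: indicator_def split: if_splits)
        next
          case False
          have "c k * indicator (cell h k) (\<tau> n - y) = 0" for k
            using False by (auto simp: c_def cell_def indicator_def)
          then have "(\<Sum>k. c k * indicator (cell h k) (\<tau> n - y)) = 0" by (simp only: suminf_zero)
          then show ?thesis by simp
        qed
      qed
      finally show ?thesis .
    qed
    then have "Liminf sequentially (\<lambda>n. \<Sum>k. cell_inf g h k * v n k) \<le> Liminf sequentially I"
      by (intro Liminf_mono always_eventually allI)
    moreover have "Liminf sequentially (\<lambda>n. \<Sum>k. cell_inf g h k * v n k) = (\<Sum>k. cell_inf g h k * (ennreal h * ennreal \<kappa>))"
      by (intro lim_imp_Liminf ennreal_series_tendsto[where K = "ennreal K"] inf_finite h v_lim)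
        (auto simp: v_def u_def K)
    moreover have "\<dots> = ennreal \<kappa> * lower_riemann_sum g h"
      unfolding scale lower_riemann_sum_def cell_inf_def cell_def ..
    ultimately show ?thesis by simp
  qed
  have pos: "eventually (\<lambda>h::real. h > 0) (at_right 0)"
    by (simp add: eventually_at_right_less)
  have "Limsup sequentially I \<le> ennreal \<kappa> * J"
  proof (rule tendsto_lowerbound)
    show "((\<lambda>h. ennreal \<kappa> * upper_riemann_sum g h) \<longlongrightarrow> ennreal \<kappa> * J) (at_right 0)"
      by (intro ennreal_tendsto_cmult limits) simp
    show "eventually (\<lambda>h. Limsup sequentially I \<le> ennreal \<kappa> * upper_riemann_sum g h) (at_right 0)"
      using pos by eventually_elim (rule upper)
  qed simp
  moreover have "ennreal \<kappa> * J \<le> Liminf sequentially I"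
  proof (rule tendsto_upperbound)
    show "((\<lambda>h. ennreal \<kappa> * lower_riemann_sum g h) \<longlongrightarrow> ennreal \<kappa> * J) (at_right 0)"
      by (intro ennreal_tendsto_cmult limits) simp
    show "eventually (\<lambda>h. ennreal \<kappa> * lower_riemann_sum g h \<le> Liminf sequentially I) (at_right 0)"
      using pos by eventually_elim (rule lower)
  qed simp
  moreover have "Liminf sequentially I \<le> Limsup sequentially I"
    by (intro Liminf_le_Limsup) simp
  ultimately have "Liminf sequentially I = ennreal \<kappa> * J" "Limsup sequentially I = ennreal \<kappa> * J"
    by (meson order_antisym order_trans)+
  then show "(\<lambda>n. \<integral>\<^sup>+y\<in>{0<..\<tau> n}. ennreal (g (\<tau> n - y)) \<partial>U) \<longlonglongrightarrow>
      ennreal \<kappa> * (\<integral>\<^sup>+y\<in>{0..}. ennreal (g y) \<partial>lebesgue)"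
    unfolding I_def[symmetric] J_def[symmetric]
    by (subst tendsto_iff_Liminf_eq_Limsup) auto
qed

section \<open>The key renewal theorem for cluster processes\<close>

theorem corollary3p10:
  fixes M :: "'a measure"
    and X :: "nat \<Rightarrow> 'a \<Rightarrow> real"
    and L :: "nat \<Rightarrow> 'a \<Rightarrow> nat"
    and T :: "nat \<Rightarrow> nat \<Rightarrow> 'a \<Rightarrow> real"
    and g :: "real \<Rightarrow> real"
    and \<mu> :: real
  assumes "renewal_cluster_process M X L T"
    and "\<mu> = prob_space.expectation M (X 1)"
    and "integrable M (\<lambda>\<omega>. real (L 0 \<omega>))"
    and "integrable M (\<lambda>\<omega>. real (L 1 \<omega>))"
    and "integrable M (\<lambda>\<omega>. real (L 1 \<omega>) * X 1 \<omega>)"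
    and "integrable M (\<lambda>\<omega>. real (L 1 \<omega>) * cluster_radius L T 1 \<omega>)"
    and "\<And>y. y \<ge> 0 \<Longrightarrow> g y \<ge> 0"
    and "directly_riemann_integrable g"
  shows "((\<lambda>t. \<integral>\<^sup>+y\<in>{0<..t}. ennreal (g (t - y)) \<partial>renewal_measure M X L T) \<longlongrightarrow>
      ennreal (1 / \<mu> * prob_space.expectation M (\<lambda>\<omega>. real (L 1 \<omega>))) *
        (\<integral>\<^sup>+y\<in>{0..}. ennreal (g y) \<partial>lebesgue)) at_top"
proof -
  interpret renewal_cluster_process M X L T by fact
  have "renewal_measure M X L T = intensity_measure"
    using assms by (intro renewal_measure_eq_intensity_measure)
  moreover have "((\<lambda>t. \<integral>\<^sup>+y\<in>{0<..t}. ennreal (g (t - y)) \<partial>intensity_measure) \<longlongrightarrow>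
      ennreal (1 / \<mu> * expectation (\<lambda>\<omega>. real (L 1 \<omega>))) *
        (\<integral>\<^sup>+y\<in>{0..}. ennreal (g y) \<partial>lebesgue)) at_top"
    unfolding assms(2)
    by (rule key_renewal_from_local_limit[OF sets_intensity_measure])
      (use assms intensity_interval_bound intensity_blackwell in auto)
  ultimately show ?thesis by simp
qed

end
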